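(* Let $\pi$ be a $p$-perturbation of a locally regular supercritical cellular automaton $\mathcal T$, let $w_\pi(u)$, $u\in S^1$, be its half-space velocities, and let $A_0$ be any finite initial set which fills space. Then, almost surely and in the Hausdorff metric, $$\frac{A_t}{t}\ \to\ L_\pi=K_{1/w_\pi}^*\qquad (t\to\infty),$$ where $K_{1/w_\pi}=\bigcup\{[0,1/w_\pi(u)]\cdot u:u\in S^1\}$ and $K_{1/w_\pi}^*=\{x\in\mathbf R^2:\langle x,u\rangle\le w_\pi(u)\text{ for all }u\in S^1\}$.
   Context: Rules. Let $\mathcal N\subset\mathbf Z^2$ be a finite neighborhood with $0\in\mathcal N$ and $-\mathcal N=\mathcal N$. A random growth rule is a map $\pi:2^{\mathcal N}\to[0,1]$ satisfying the standing assumptions: monotone ($\pi(S_1)\le\pi(S_2)$ whenever $S_1\subset S_2$); $\pi(\varnothing)=0$; symmetric ($\pi(-S)=\pi(S)$); solidification ($\pi(S)=1$ whenever $0\in S$). Given an initial set $A_0\subset\mathbf Z^2$, the random sets $A_1,A_2,\dots$ are generated as follows: given $A_t$, each $x\in\mathbf Z^2$ belongs to $A_{t+1}$ with probability $\pi\big(((x+\mathcal N)\cap A_t)-x\big)$, independently over all $x$ and $t$. Associated deterministic CA. Put $\pi_d(S)=1$ if $\pi(S)>0$ and $\pi_d(S)=0$ otherwise, and $\mathcal T(A)=A\cup\{x\in\mathbf Z^2:\pi_d((A-x)\cap\mathcal N)=1\}$ for $A\subset\mathbf Z^2$. With $p=\min\{\pi(S):\pi(S)>0\}$, $\pi$ is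 called a $p$-perturbation of the cellular automaton (CA) $\mathcal T$. A set $A$ fills space if $\bigcup_{t\ge0}\mathcal T^t(A)=\mathbf Z^2$. Half-spaces. $S^1\subset\mathbf R^2$ is the set of unit vectors and $H_u^-=\{x\in\mathbf R^2:\langle x,u\rangle\le0\}$. For closed $B\subset\mathbf R^2$ let $\bar{\mathcal T}(B)=\{x\in\mathbf R^2:0\in\mathcal T((B-x)\cap\mathbf Z^2)\}$. For each $u\in S^1$ there is $w(u)\in\mathbf R$ with $\bar{\mathcal T}(H_u^-)=H_u^-+w(u)u$. The CA is supercritical if $w(u)>0$ for every $u\in S^1$. Local regularity. $\mathcal T$ is locally regular if for every initial state $A_0$ (initial states are assumed to fill space) there is a constant $C$ such that for every sequence $A_0\subset A_1\subset\cdots$ with $A_t\subset A_{t+1}\subset\mathcal T(A_t)$, and every $t$: every $x\in A_t$ at distance at least $C$ from $A_0$ has a set $G\subset A_t$, entirely within distance $C$ of $x$, that fills space. Half-space velocity. For $u\in S^1$, $w_\pi(u)>0$ denotes the deterministic number such that, for the dynamics started from $A_0=H_u^-\cap\mathbf Z^2$, for every $\varepsilon>0$ there is $c_\varepsilon>0$ so that with probability at least $1-\exp(-c_\varepsilon t)$ one has $H_u^-+t(w_\pi(u)-\varepsilon)u\subset A_t\subset H_u^-+t(w_\pi(u)+\varepsilon)u$ within the lattice ball of radius $t^2$ (it exists for every $p$-perturbation of a locally regular supercritical CA). *)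

theory Defs
  imports "HOL-Probability.Probability"
begin

type_synonym site = "int \<times> int"
type_synonym plane = "real \<times> real"

definition emb :: "site \<Rightarrow> plane" where
  "emb x = (real_of_int (fst x), real_of_int (snd x))"

(* The configuration seen from x, i.e. ((x + N) \<inter> A) - x = (A - x) \<inter> N. *)
definition local_config :: "site set \<Rightarrow> site set \<Rightarrow> site \<Rightarrow> site set" where
  "local_config N A x = {y \<in> N. x + y \<in> A}"

(* Only the values of \<pi> on subsets of N are meaningful. *)
definition growth_rule :: "site set \<Rightarrow> (site set \<Rightarrow> real) \<Rightarrow> bool" where
  "growth_rule N \<pi> \<longleftrightarrow>
     finite N \<and> 0 \<in> N \<and> uminus ` N = N \<and>
     (\<forall>S\<subseteq>N. 0 \<le> \<pi> S \<and> \<pi> S \<le> 1) \<and>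
     (\<forall>S1 S2. S1 \<subseteq> S2 \<and> S2 \<subseteq> N \<longrightarrow> \<pi> S1 \<le> \<pi> S2) \<and>
     \<pi> {} = 0 \<and>
     (\<forall>S\<subseteq>N. \<pi> (uminus ` S) = \<pi> S) \<and>
     (\<forall>S\<subseteq>N. 0 \<in> S \<longrightarrow> \<pi> S = 1)"

definition det_rule :: "(site set \<Rightarrow> real) \<Rightarrow> site set \<Rightarrow> real" where
  "det_rule \<pi> S = (if \<pi> S > 0 then 1 else 0)"

definition assoc_CA :: "site set \<Rightarrow> (site set \<Rightarrow> real) \<Rightarrow> site set \<Rightarrow> site set" where
  "assoc_CA N \<pi> A = A \<union> {x. det_rule \<pi> (local_config N A x) = 1}"

definition perturbation ::
  "site set \<Rightarrow> (site set \<Rightarrow> real) \<Rightarrow> real \<Rightarrow> (site set \<Rightarrow> site set) \<Rightarrow> bool" where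
  "perturbation N \<pi> p T \<longleftrightarrow>
     growth_rule N \<pi> \<and> p = Min {\<pi> S | S. S \<subseteq> N \<and> \<pi> S > 0} \<and> T = assoc_CA N \<pi>"

definition fills_space :: "(site set \<Rightarrow> site set) \<Rightarrow> site set \<Rightarrow> bool" where
  "fills_space T A \<longleftrightarrow> (\<Union>t. (T ^^ t) A) = UNIV"

definition half_space :: "plane \<Rightarrow> plane set" where
  "half_space u = {x. x \<bullet> u \<le> 0}"

(* Here {z. emb z + x \<in> B} is (B - x) \<inter> Z^2. *)
definition extend_CA :: "(site set \<Rightarrow> site set) \<Rightarrow> plane set \<Rightarrow> plane set" where
  "extend_CA T B = {x. 0 \<in> T {z. emb z + x \<in> B}}"

(* The real number v below is uniquely determined by T and u; it is the speed w(u) of the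
   deterministic automaton started from a half-space. *)
definition supercritical :: "(site set \<Rightarrow> site set) \<Rightarrow> bool" where
  "supercritical T \<longleftrightarrow>
     (\<forall>u\<in>sphere 0 1. \<exists>v>0. extend_CA T (half_space u) = (+) (v *\<^sub>R u) ` half_space u)"

(* The initial states A0 may be infinite. *)
definition locally_regular :: "(site set \<Rightarrow> site set) \<Rightarrow> bool" where
  "locally_regular T \<longleftrightarrow>
     (\<forall>A0. fills_space T A0 \<longrightarrow>
       (\<exists>C. \<forall>A. A 0 = A0 \<and> (\<forall>t. A t \<subseteq> A (Suc t) \<and> A (Suc t) \<subseteq> T (A t)) \<longrightarrow>
         (\<forall>t. \<forall>x\<in>A t. (\<forall>y\<in>A0. C \<le> dist (emb x) (emb y)) \<longrightarrow>
            (\<exists>G\<subseteq>A t. (\<forall>y\<in>G. dist (emb x) (emb y) \<le> C) \<and> fills_space T G))))"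

definition history :: "'w measure \<Rightarrow> (nat \<Rightarrow> 'w \<Rightarrow> site set) \<Rightarrow> nat \<Rightarrow> 'w measure" where
  "history M A t = sigma (space M) {{\<omega> \<in> space M. x \<in> A s \<omega>} | s x. s \<le> t}"

(* The last clause is the law of one step: conditionally on A 0, ..., A t, the events
   "x belongs to A (Suc t)", for x ranging over the lattice, are independent (product formula over
   all finite sets F of sites) with probabilities \<pi> (local_config N (A t) x). *)
definition growth_process ::
  "'w measure \<Rightarrow> site set \<Rightarrow> (site set \<Rightarrow> real) \<Rightarrow> site set \<Rightarrow> (nat \<Rightarrow> 'w \<Rightarrow> site set) \<Rightarrow> bool"
where
  "growth_process M N \<pi> A0 A \<longleftrightarrow>
     prob_space M \<and>
     (\<forall>t x. {\<omega> \<in> space M. x \<in> A t \<omega>} \<in> sets M) \<and>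
     (AE \<omega> in M. A 0 \<omega> = A0) \<and>
     (\<forall>t F. finite F \<longrightarrow>
        (AE \<omega> in M.
           real_cond_exp M (history M A t) (indicator {\<omega> \<in> space M. F \<subseteq> A (Suc t) \<omega>}) \<omega>
           = (\<Prod>x\<in>F. \<pi> (local_config N (A t \<omega>) x))))"

(* The property depends only on the law of the process, so the dynamics from the half-space is
   taken on the space of trajectories, as coordinate process. *)
definition half_space_velocity ::
  "site set \<Rightarrow> (site set \<Rightarrow> real) \<Rightarrow> plane \<Rightarrow> real \<Rightarrow> bool" where
  "half_space_velocity N \<pi> u v \<longleftrightarrow>
     v > 0 \<and>
     (\<forall>M :: (nat \<Rightarrow> site set) measure.
        growth_process M N \<pi> {x. emb x \<in> half_space u} (\<lambda>t \<omega>. \<omega> t) \<longrightarrow>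
        (\<forall>\<epsilon>>0. \<exists>c>0. \<forall>t.
           measure M {\<omega> \<in> space M. \<forall>x. norm (emb x) \<le> (real t)\<^sup>2 \<longrightarrow>
             (emb x \<in> (+) ((real t * (v - \<epsilon>)) *\<^sub>R u) ` half_space u \<longrightarrow> x \<in> \<omega> t) \<and>
             (x \<in> \<omega> t \<longrightarrow> emb x \<in> (+) ((real t * (v + \<epsilon>)) *\<^sub>R u) ` half_space u)}
           \<ge> 1 - exp (- c * real t)))"

definition K_inv :: "(plane \<Rightarrow> real) \<Rightarrow> plane set" where
  "K_inv w = (\<Union>u\<in>sphere 0 1. (\<lambda>r. r *\<^sub>R u) ` {0..1 / w u})"

definition K_inv_star :: "(plane \<Rightarrow> real) \<Rightarrow> plane set" where
  "K_inv_star w = {x. \<forall>u\<in>sphere 0 1. x \<bullet> u \<le> w u}"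

lemma K_inv_star_eq_polar:
  assumes "\<And>u. u \<in> sphere 0 1 \<Longrightarrow> w u > 0"
  shows "K_inv_star w = {x. \<forall>y\<in>K_inv w. x \<bullet> y \<le> 1}"
proof (intro set_eqI iffI)
  fix x assume x: "x \<in> K_inv_star w"
  have "r * (x \<bullet> u) \<le> 1" if u: "u \<in> sphere 0 1" and r: "0 \<le> r" "r \<le> 1 / w u" for u r
  proof -
    have "r * (x \<bullet> u) \<le> r * w u"
      using x u r(1) by (auto simp: K_inv_star_def intro!: mult_left_mono)
    also have "\<dots> \<le> 1"
      using r(2) assms[OF u] by (simp add: field_simps)
    finally show ?thesis .
  qed
  then show "x \<in> {x. \<forall>y\<in>K_inv w. x \<bullet> y \<le> 1}"
    by (auto simp: K_inv_def)
next
  fix x assume x: "x \<in> {x. \<forall>y\<in>K_inv w. x \<bullet> y \<le> 1}"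
  show "x \<in> K_inv_star w"
    unfolding K_inv_star_def
  proof safe
    fix u :: plane assume u: "u \<in> sphere 0 1"
    have "(1 / w u) *\<^sub>R u \<in> K_inv w"
      using u assms[OF u] unfolding K_inv_def by force
    with x have "x \<bullet> ((1 / w u) *\<^sub>R u) \<le> 1"
      by blast
    then show "x \<bullet> u \<le> w u"
      using assms[OF u] by (simp add: field_simps)
  qed
qed

(* Extended-valued, so that unbounded or empty sets are at infinite distance from nonempty
   compact ones; on nonempty compact sets this is the Hausdorff metric. *)
definition hausdorff_distance :: "'a::metric_space set \<Rightarrow> 'a set \<Rightarrow> ennreal" where
  "hausdorff_distance A B =
     max (SUP a\<in>A. INF b\<in>B. ennreal (dist a b)) (SUP b\<in>B. INF a\<in>A. ennreal (dist a b))"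

definition scaled :: "site set \<Rightarrow> nat \<Rightarrow> plane set" where
  "scaled A t = (\<lambda>x. emb x /\<^sub>R real t) ` A"

end

theory Submission
  imports Defs "HOL-Real_Asymp.Real_Asymp"
begin

text \<open>The limit shape is the intersection of the half-planes that rescaled growing half-spaces fill. Both
inclusions compare the finite process with half-spaces, inside one coupling \<open>X\<close> in which
monotonicity, solidification and finite speed hold pointwise.

\<^emph>\<open>Upper bound.\<close> A finite set lies in a translate of every discrete half-space. Hence, for a fixed
direction \<open>u\<close> and \<open>e > 0\<close>, the process leaves the half-plane \<open>x \<bullet> u \<le> t (w u + e)\<close> with exponentially
small probability (\<open>finite_upper\<close>). By compactness finitely many such half-planes already confine
\<open>A t / t\<close> to a neighbourhood of \<open>K_inv_star w\<close> (\<open>finitely_many_half_planes\<close>), and the Borel-Cantelli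
lemma finishes.

\<^emph>\<open>Lower bound.\<close> The shape may have corners, where it does not look like a half-space on any scale.
It is therefore replaced by a union \<open>E\<close> of balls of one fixed radius that fills it up to a small error
and satisfies \<open>y \<bullet> u \<le> w u - \<delta>\<close> for all \<open>y \<in> E\<close> and all unit vectors \<open>u\<close>. During \<open>s\<close> steps a site feels
only what lies within distance of order \<open>s\<close>, and there the boundary of the dilate \<open>R E\<close> differs from a
half-space by order \<open>s\<^sup>2 / R\<close>, which is negligible against \<open>\<delta> s\<close> when \<open>s / R\<close> is small. So the
half-space velocity pushes \<open>R E\<close> to \<open>(R + s) E\<close> except on an event of probability exponentially small
in \<open>s\<close> (\<open>droplet_growth_step\<close>). The rates supplied by the half-space velocity depend on the direction in
an uncontrolled way, but since the inequality for \<open>E\<close> holds in all directions at once, every direction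
may be replaced by a nearby one from a finite net (\<open>tangent_half_space\<close>).

The droplet argument needs a start of size proportional to \<open>t\<close> and a ball inside the shape.
Both come from seeds. If \<open>G\<close> is finite and fills space, then for some \<open>n\<close> and \<open>q > 0\<close> a
copy of \<open>G\<close> produces within \<open>n\<close> steps each of its four neighbouring copies with probability at least
\<open>q\<close>. Copies of \<open>G\<close> thus travel at positive speed up to exponentially small probabilities
(\<open>seed_linear_growth\<close>). This fills a ball of radius proportional to \<open>t\<close> in a small fraction of the
time \<open>t\<close> (\<open>seed_fills_ball\<close>), from which a bounded number of droplet steps reaches
\<open>(1 - \<theta>) t E\<close> (\<open>droplet_linear_growth\<close>); it also bounds \<open>w\<close> away from \<open>0\<close>
(\<open>velocity_bounded_below\<close>).

Every error event concerns a single time and, up to a null set, a finite window, so for an arbitrary process with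
the given one-step law it is enough that the law at each fixed time agrees with that of \<open>X\<close>
(\<open>one_step_law_hit\<close>). The same uniqueness gives translation invariance, and the law of \<open>X\<close> on
trajectories (\<open>growth_process_traj_law\<close>) is the process to which the half-space velocities refer.\<close>

section \<open>Graphical construction\<close>

text \<open>Restricting the space to the half-open interval, instead of taking the uniform law on the whole line,
makes \<open>u < 0\<close> false and \<open>u < 1\<close> true at every point. Hence sites with success probability \<open>0\<close> or \<open>1\<close>
behave deterministically everywhere and not only almost surely.\<close>

definition unif :: "real measure" where
  "unif = restrict_space lborel {0..<1}"

abbreviation noise :: "(site \<Rightarrow> real) measure" where
  "noise \<equiv> PiM UNIV (\<lambda>_. unif)"

abbreviation env :: "(nat \<Rightarrow> site \<Rightarrow> real) measure" where
  "env \<equiv> PiM UNIV (\<lambda>_. noise)"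

lemma prob_space_unif: "prob_space unif"
  by (rule prob_spaceI) (simp add: unif_def space_restrict_space emeasure_restrict_space)

lemma space_unif: "space unif = {0..<1}"
  by (simp add: unif_def space_restrict_space)

lemma measurable_unif_borel [measurable]: "(\<lambda>u. u) \<in> measurable unif borel"
  unfolding unif_def by (rule measurable_restrict_space1) simp

lemma measure_unif_less:
  assumes "0 \<le> a" "a \<le> 1"
  shows "measure unif {u \<in> space unif. u < a} = a"
proof -
  have "{u \<in> space unif. u < a} = {0..<a}" using assms by (auto simp: space_unif)
  moreover have "measure unif {0..<a} = measure lborel {0..<a}"
    using assms unfolding unif_def by (intro measure_restrict_space) auto
  ultimately show ?thesis using assms by simp
qed

interpretation unif: prob_space unif by (rule prob_space_unif)
interpretation noise: product_prob_space "\<lambda>_::site. unif" UNIV ..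
interpretation env: sequence_space noise ..

lemma space_env: "\<omega> \<in> space env \<Longrightarrow> 0 \<le> \<omega> t x \<and> \<omega> t x < 1"
  by (cases x) (auto simp: space_PiM PiE_iff space_unif)

lemma measurable_env_component [measurable]: "(\<lambda>\<omega>. \<omega> t x) \<in> borel_measurable env"
proof -
  have "(\<lambda>\<omega>. \<omega> t) \<in> measurable env noise" "(\<lambda>s. s x) \<in> measurable noise unif"
    by (rule measurable_component_singleton; simp)+
  then have "(\<lambda>\<omega>. \<omega> t x) \<in> measurable env unif" by (rule measurable_compose)
  from measurable_compose[OF this measurable_unif_borel] show ?thesis .
qed

lemma sets_subset_event:
  fixes F :: "site set"
  assumes "\<And>x. {\<omega> \<in> space M. x \<in> B \<omega>} \<in> sets M"
  shows "{\<omega> \<in> space M. F \<subseteq> B \<omega>} \<in> sets M"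
proof -
  have "{\<omega> \<in> space M. F \<subseteq> B \<omega>} = {\<omega> \<in> space M. \<forall>x\<in>F. x \<in> B \<omega>}" by auto
  also have "\<dots> \<in> sets M" using assms
    by (intro sets.sets_Collect_countable_Ball) auto
  finally show ?thesis .
qed

locale random_growth =
  fixes N :: "site set" and \<pi> :: "site set \<Rightarrow> real"
  assumes rule: "growth_rule N \<pi>"
begin

lemma finite_N [simp]: "finite N" and zero_in_N [simp]: "0 \<in> N"
  using rule by (auto simp: growth_rule_def)

lemma config_subset: "local_config N A x \<subseteq> N"
  by (auto simp: local_config_def)

lemma config_mono: "A \<subseteq> B \<Longrightarrow> local_config N A x \<subseteq> local_config N B x"
  by (auto simp: local_config_def)

abbreviation occ :: "site set \<Rightarrow> site \<Rightarrow> real" where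
  "occ A x \<equiv> \<pi> (local_config N A x)"

lemma occ_bounds: "0 \<le> occ A x" "occ A x \<le> 1"
  using rule config_subset[of A x] by (auto simp: growth_rule_def)

lemma occ_mono: "A \<subseteq> B \<Longrightarrow> occ A x \<le> occ B x"
  using rule config_subset[of B x] config_mono[of A B x] by (auto simp: growth_rule_def)

lemma occ_eq_1: "x \<in> A \<Longrightarrow> occ A x = 1"
proof -
  assume "x \<in> A"
  then have "0 \<in> local_config N A x" by (simp add: local_config_def)
  then show ?thesis using rule config_subset[of A x] by (auto simp: growth_rule_def)
qed

lemma occ_eq_0: "(\<And>y. y \<in> N \<Longrightarrow> x + y \<notin> A) \<Longrightarrow> occ A x = 0"
proof -
  assume "\<And>y. y \<in> N \<Longrightarrow> x + y \<notin> A"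
  then have "local_config N A x = {}" by (auto simp: local_config_def)
  then show ?thesis using rule by (simp add: growth_rule_def)
qed

text \<open>The environment \<open>\<omega>\<close> attaches an independent uniform variable to every space-time point. All
initial sets use the same environment, so processes started from different sets are coupled.\<close>

primrec X :: "nat \<Rightarrow> site set \<Rightarrow> (nat \<Rightarrow> site \<Rightarrow> real) \<Rightarrow> site set" where
  "X 0 A \<omega> = A"
| "X (Suc t) A \<omega> = {x. \<omega> t x < occ (X t A \<omega>) x}"

lemma X_mono: "A \<subseteq> B \<Longrightarrow> X t A \<omega> \<subseteq> X t B \<omega>"
proof (induction t)
  case (Suc t)
  then show ?case using occ_mono[of "X t A \<omega>" "X t B \<omega>"] by (auto intro: less_le_trans)
qed simp

lemma X_Suc_mono: "\<omega> \<in> space env \<Longrightarrow> X t A \<omega> \<subseteq> X (Suc t) A \<omega>"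
  by (auto simp: occ_eq_1 space_env)

lemma X_increasing: "\<omega> \<in> space env \<Longrightarrow> s \<le> t \<Longrightarrow> X s A \<omega> \<subseteq> X t A \<omega>"
  by (rule lift_Suc_mono_le[of "\<lambda>t. X t A \<omega>"]) (use X_Suc_mono in auto)

lemma X_cong_env:
  "(\<And>s. s < t \<Longrightarrow> \<omega> s = \<omega>' s) \<Longrightarrow> X t A \<omega> = X t A \<omega>'"
  by (induction t) auto

text \<open>The Markov property in pathwise form: after time \<open>m\<close> the process starts afresh from \<open>X m A \<omega>\<close> with the
shifted environment \<open>\<omega>'\<close>.\<close>

lemma X_comb_seq: "X (m + k) A (comb_seq m \<omega> \<omega>') = X k (X m A \<omega>) \<omega>'"
proof (induction k)
  case 0
  have "X m A (comb_seq m \<omega> \<omega>') = X m A \<omega>"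
    by (rule X_cong_env) (simp add: comb_seq_less)
  then show ?case by simp
next
  case (Suc k)
  have "comb_seq m \<omega> \<omega>' (m + k) = \<omega>' k"
    using comb_seq_add[of m \<omega> \<omega>' k] by (simp add: add.commute)
  with Suc show ?case by simp
qed

lemma config_measurable:
  assumes "\<And>x. {\<omega> \<in> space M. x \<in> B \<omega>} \<in> sets M"
  shows "(\<lambda>\<omega>. local_config N (B \<omega>) x) \<in> measurable M (count_space UNIV)"
proof (rule measurable_compose[of _ _ "count_space (Pow N)" "\<lambda>S. S"])
  show "(\<lambda>\<omega>. local_config N (B \<omega>) x) \<in> measurable M (count_space (Pow N))"
  proof (subst measurable_count_space_eq2, simp, intro conjI ballI)
    show "(\<lambda>\<omega>. local_config N (B \<omega>) x) \<in> space M \<rightarrow> Pow N" using config_subset by auto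
    fix S assume "S \<in> Pow N"
    then have eq: "(\<lambda>\<omega>. local_config N (B \<omega>) x) -` {S} \<inter> space M
       = {\<omega> \<in> space M. \<forall>y\<in>N. (x + y \<in> B \<omega>) = (y \<in> S)}"
      by (auto simp: local_config_def)
    show "(\<lambda>\<omega>. local_config N (B \<omega>) x) -` {S} \<inter> space M \<in> sets M"
      unfolding eq
    proof (rule sets.sets_Collect_finite_All)
      fix y
      have "{\<omega> \<in> space M. x + y \<in> B \<omega>} \<in> sets M" by (rule assms)
      then show "{\<omega> \<in> space M. (x + y \<in> B \<omega>) = (y \<in> S)} \<in> sets M"
        by (cases "y \<in> S") (auto intro: sets.sets_Collect_neg)
    qed auto
  qed
qed simp

lemma occ_measurable:
  assumes "\<And>x. {\<omega> \<in> space M. x \<in> B \<omega>} \<in> sets M"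
  shows "(\<lambda>\<omega>. occ (B \<omega>) x) \<in> borel_measurable M"
  by (rule measurable_compose[OF config_measurable[OF assms]]) auto

lemma X_measurable: "{\<omega> \<in> space env. x \<in> X t A \<omega>} \<in> sets env"
proof (induction t arbitrary: x)
  case (Suc t)
  have [measurable]: "(\<lambda>\<omega>. occ (X t A \<omega>) x) \<in> borel_measurable env" for x
    by (rule occ_measurable) (rule Suc)
  show ?case by simp
qed simp

text \<open>Almost all estimates below are stated through this probability: it is monotone in \<open>A\<close>, \<open>t\<close> and (reversed)
\<open>F\<close>, and it can be concatenated in time.\<close>

definition hit :: "nat \<Rightarrow> site set \<Rightarrow> site set \<Rightarrow> real" where
  "hit t A F = measure env {\<omega> \<in> space env. F \<subseteq> X t A \<omega>}"

lemma hit_sets [measurable]: "{\<omega> \<in> space env. F \<subseteq> X t A \<omega>} \<in> sets env"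
  by (rule sets_subset_event) (rule X_measurable)

lemma hit_bounds: "0 \<le> hit t A F" "hit t A F \<le> 1"
  by (auto simp: hit_def)

lemma hit_mono: "A \<subseteq> B \<Longrightarrow> F' \<subseteq> F \<Longrightarrow> hit t A F \<le> hit t B F'"
  unfolding hit_def
  by (intro env.P.finite_measure_mono hit_sets Collect_mono) (use X_mono[of A B t] in blast)

lemma hit_mono_time: "s \<le> t \<Longrightarrow> hit s A F \<le> hit t A F"
  unfolding hit_def
  by (intro env.P.finite_measure_mono hit_sets Collect_mono) (use X_increasing[of _ s t A] in blast)

lemma hit_self: "F \<subseteq> A \<Longrightarrow> hit t A F = 1"
proof -
  assume F: "F \<subseteq> A"
  have "hit 0 A F = 1" using F by (simp add: hit_def env.P.prob_space)
  with hit_mono_time[of 0 t A F] hit_bounds[of t A F] show ?thesis by simp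
qed

text \<open>Markov property. \<open>E\<close> is an event of the first \<open>m\<close> steps; splitting the environment at time \<open>m\<close> into
two independent ones and applying Fubini's theorem leaves the hitting probability from the set
\<open>X m A \<omega>\<close>.\<close>

lemma
  assumes E: "E \<in> sets env"
    and past: "\<And>\<omega> \<omega>'. \<omega> \<in> space env \<Longrightarrow> \<omega>' \<in> space env \<Longrightarrow>
      (\<And>s. s < m \<Longrightarrow> \<omega> s = \<omega>' s) \<Longrightarrow> \<omega> \<in> E \<Longrightarrow> \<omega>' \<in> E"
  shows markov_measurable_past: "(\<lambda>\<omega>. indicator E \<omega> * hit k (X m A \<omega>) F) \<in> borel_measurable env"
    and markov_past: "measure env (E \<inter> {\<omega> \<in> space env. F \<subseteq> X (m + k) A \<omega>})
      = (\<integral>\<omega>. indicator E \<omega> * hit k (X m A \<omega>) F \<partial>env)"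
proof -
  let ?g = "\<lambda>\<omega>. indicator E \<omega> * hit k (X m A \<omega>) F"
  let ?S = "E \<inter> {\<omega> \<in> space env. F \<subseteq> X (m + k) A \<omega>}"
  let ?f = "\<lambda>(\<omega>, \<omega>'). comb_seq m \<omega> \<omega>'"
  define Q where "Q = ?f -` ?S \<inter> space (env \<Otimes>\<^sub>M env)"
  have S: "?S \<in> sets env" using E hit_sets by (rule sets.Int)
  have Q: "Q \<in> sets (env \<Otimes>\<^sub>M env)"
    unfolding Q_def by (rule measurable_sets[OF measurable_comb_seq S])
  have g: "0 \<le> ?g \<omega>" "?g \<omega> \<le> 1" for \<omega>
    using hit_bounds by (auto simp: indicator_def)
  have slice: "Pair \<omega> -` Q = (if \<omega> \<in> E then {\<omega>' \<in> space env. F \<subseteq> X k (X m A \<omega>) \<omega>'} else {})"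
    if w: "\<omega> \<in> space env" for \<omega>
  proof -
    have sp: "comb_seq m \<omega> \<omega>' \<in> space env" if "\<omega>' \<in> space env" for \<omega>'
      using that w measurable_space[OF measurable_comb_seq[of m noise], of "(\<omega>, \<omega>')"]
      by (simp add: space_pair_measure)
    have "comb_seq m \<omega> \<omega>' \<in> E \<longleftrightarrow> \<omega> \<in> E" if "\<omega>' \<in> space env" for \<omega>'
      using past[OF w sp[OF that]] past[OF sp[OF that] w] by (auto simp: comb_seq_less)
    then show ?thesis using w sp
      by (auto simp: Q_def X_comb_seq space_pair_measure)
  qed
  have em: "emeasure env (Pair \<omega> -` Q) = ennreal (?g \<omega>)" if "\<omega> \<in> space env" for \<omega>
    using slice[OF that] by (simp add: hit_def env.P.emeasure_eq_measure)
  have "(\<lambda>\<omega>. emeasure env (Pair \<omega> -` Q)) \<in> borel_measurable env"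
    by (rule env.P.measurable_emeasure_Pair[OF Q])
  then have "(\<lambda>\<omega>. enn2real (emeasure env (Pair \<omega> -` Q))) \<in> borel_measurable env"
    by measurable
  also have "?this \<longleftrightarrow> ?g \<in> borel_measurable env"
    by (rule measurable_cong) (simp only: em enn2real_ennreal[OF g(1)])
  finally show meas: "?g \<in> borel_measurable env" .
  have "ennreal (measure env ?S) = emeasure env ?S"
    by (simp add: env.P.emeasure_eq_measure)
  also have "\<dots> = emeasure (distr (env \<Otimes>\<^sub>M env) env ?f) ?S"
    by (simp only: env.PiM_comb_seq)
  also have "\<dots> = emeasure (env \<Otimes>\<^sub>M env) Q"
    unfolding Q_def by (rule emeasure_distr[OF measurable_comb_seq S])
  also have "\<dots> = (\<integral>\<^sup>+\<omega>. emeasure env (Pair \<omega> -` Q) \<partial>env)"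
    by (rule env.P.emeasure_pair_measure_alt[OF Q])
  also have "\<dots> = (\<integral>\<^sup>+\<omega>. ennreal (?g \<omega>) \<partial>env)"
    by (rule nn_integral_cong) (rule em)
  also have "\<dots> = ennreal (\<integral>\<omega>. ?g \<omega> \<partial>env)"
    using meas g
    by (intro nn_integral_eq_integral env.P.integrable_const_bound[where B=1]) auto
  finally show "measure env ?S = (\<integral>\<omega>. ?g \<omega> \<partial>env)"
    by (subst (asm) ennreal_inj) (use g in \<open>auto intro!: integral_nonneg_AE\<close>)
qed

lemma
  shows markov_measurable: "(\<lambda>\<omega>. hit k (X m A \<omega>) F) \<in> borel_measurable env"
    and markov: "hit (m + k) A F = (\<integral>\<omega>. hit k (X m A \<omega>) F \<partial>env)"
proof -
  have eq: "indicator (space env) \<omega> * hit k (X m A \<omega>) F = hit k (X m A \<omega>) F" if "\<omega> \<in> space env" for \<omega>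
    using that by simp
  show "(\<lambda>\<omega>. hit k (X m A \<omega>) F) \<in> borel_measurable env"
    using markov_measurable_past[of "space env" m k A F] by (simp cong: measurable_cong)
  have "hit (m + k) A F = measure env (space env \<inter> {\<omega> \<in> space env. F \<subseteq> X (m + k) A \<omega>})"
    by (simp add: hit_def Int_absorb1)
  also have "\<dots> = (\<integral>\<omega>. indicator (space env) \<omega> * hit k (X m A \<omega>) F \<partial>env)"
    by (rule markov_past) auto
  also have "\<dots> = (\<integral>\<omega>. hit k (X m A \<omega>) F \<partial>env)"
    by (rule Bochner_Integration.integral_cong[OF refl eq])
  finally show "hit (m + k) A F = (\<integral>\<omega>. hit k (X m A \<omega>) F \<partial>env)" .
qed

text \<open>Either \<open>D\<close> has been reached at time \<open>m\<close>, or at least \<open>D0\<close> is still occupied, because nothing is ever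
lost. The second alternative is what allows repeated attempts; \<open>D0 = {}\<close> gives the plain product bound.\<close>

lemma hit_concat:
  assumes "D0 \<subseteq> A"
  shows "hit m A D * hit k D F + (1 - hit m A D) * hit k D0 F \<le> hit (m + k) A F"
proof -
  let ?E = "{\<omega> \<in> space env. D \<subseteq> X m A \<omega>}"
  have i: "integrable env (indicator ?E :: _ \<Rightarrow> real)"
    by (rule env.P.integrable_const_bound[where B=1]) (auto simp: indicator_def)
  have "hit m A D * hit k D F + (1 - hit m A D) * hit k D0 F
     = hit k D0 F + (hit k D F - hit k D0 F) * hit m A D"
    by (simp add: algebra_simps)
  also have "\<dots> = (\<integral>\<omega>. hit k D0 F + (hit k D F - hit k D0 F) * indicator ?E \<omega> \<partial>env)"
    using i by (simp add: env.P.prob_space hit_def Int_def conj_ac)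
  also have "\<dots> \<le> (\<integral>\<omega>. hit k (X m A \<omega>) F \<partial>env)"
  proof (rule integral_mono)
    show "integrable env (\<lambda>\<omega>. hit k D0 F + (hit k D F - hit k D0 F) * indicator ?E \<omega>)"
      using i by (intro Bochner_Integration.integrable_add integrable_mult_right) auto
    show "integrable env (\<lambda>\<omega>. hit k (X m A \<omega>) F)"
      using hit_bounds by (intro env.P.integrable_const_bound[where B=1] markov_measurable) auto
    fix \<omega> assume w: "\<omega> \<in> space env"
    have "D0 \<subseteq> X m A \<omega>" using X_increasing[OF w, of 0 m A] assms by auto
    then show "hit k D0 F + (hit k D F - hit k D0 F) * indicator ?E \<omega> \<le> hit k (X m A \<omega>) F"
      using w by (auto simp: indicator_def intro: hit_mono)
  qed
  also have "\<dots> = hit (m + k) A F" by (rule markov[symmetric])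
  finally show ?thesis .
qed

text \<open>Over one step the sites are independent, so \<open>X\<close> has the prescribed transition law.\<close>

lemma hit_one_step:
  assumes "finite F"
  shows "hit 1 A F = (\<Prod>x\<in>F. occ A x)"
proof -
  let ?U = "\<lambda>x. {u \<in> space unif. u < occ A x}"
  have U: "?U x \<in> sets unif" for x by measurable
  have U2: "{s \<in> space noise. \<forall>x\<in>F. s x \<in> ?U x} \<in> sets noise"
    using U assms by (intro sets.sets_Collect_finite_All sets_Collect_single) auto
  have "{\<omega> \<in> space env. F \<subseteq> X 1 A \<omega>} = {\<omega> \<in> space env. \<omega> 0 \<in> {s \<in> space noise. \<forall>x\<in>F. s x \<in> ?U x}}"
    by (auto simp: space_PiM PiE_iff)
  then have "emeasure env {\<omega> \<in> space env. F \<subseteq> X 1 A \<omega>} = emeasure noise {s \<in> space noise. \<forall>x\<in>F. s x \<in> ?U x}"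
    using env.emeasure_PiM_Collect_single[of 0, OF _ U2] by simp
  also have "\<dots> = (\<Prod>x\<in>F. emeasure unif (?U x))"
    using assms U by (intro noise.emeasure_PiM_Collect) auto
  also have "\<dots> = (\<Prod>x\<in>F. ennreal (occ A x))"
    by (intro prod.cong refl) (simp add: unif.emeasure_eq_measure measure_unif_less occ_bounds)
  also have "\<dots> = ennreal (\<Prod>x\<in>F. occ A x)"
    by (intro prod_ennreal) (auto simp: occ_bounds)
  finally show ?thesis
    by (simp add: hit_def env.P.emeasure_eq_measure prod_nonneg occ_bounds)
qed

end

section \<open>Uniqueness of the one-step dynamics\<close>

lemma sets_avoid_event:
  fixes V :: "site set"
  assumes "\<And>x. {\<omega> \<in> space M. x \<in> B \<omega>} \<in> sets M"
  shows "{\<omega> \<in> space M. B \<omega> \<inter> V = {}} \<in> sets M"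
proof -
  have "{\<omega> \<in> space M. B \<omega> \<inter> V = {}} = {\<omega> \<in> space M. \<forall>x\<in>V. x \<notin> B \<omega>}" by auto
  also have "\<dots> \<in> sets M" using assms
    by (intro sets.sets_Collect_countable_Ball sets.sets_Collect_neg) auto
  finally show ?thesis .
qed

locale random_set = prob_space M for M :: "'w measure" +
  fixes B :: "'w \<Rightarrow> site set"
  assumes meas: "\<And>x. {\<omega> \<in> space M. x \<in> B \<omega>} \<in> sets M"
begin

lemma sets_mixed: "{\<omega> \<in> space M. F \<subseteq> B \<omega> \<and> B \<omega> \<inter> V = {}} \<in> sets M"
  by (intro sets.sets_Collect_conj sets_subset_event sets_avoid_event meas)

text \<open>Inclusion-exclusion, one excluded site at a time: it reduces events with holes to
events of the form \<open>F \<subseteq> B \<omega>\<close>.\<close>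

lemma prob_mixed_insert:
  "prob {\<omega> \<in> space M. F \<subseteq> B \<omega> \<and> B \<omega> \<inter> insert v V = {}}
   = prob {\<omega> \<in> space M. F \<subseteq> B \<omega> \<and> B \<omega> \<inter> V = {}}
     - prob {\<omega> \<in> space M. insert v F \<subseteq> B \<omega> \<and> B \<omega> \<inter> V = {}}"
proof -
  have "{\<omega> \<in> space M. F \<subseteq> B \<omega> \<and> B \<omega> \<inter> insert v V = {}}
     = {\<omega> \<in> space M. F \<subseteq> B \<omega> \<and> B \<omega> \<inter> V = {}} - {\<omega> \<in> space M. insert v F \<subseteq> B \<omega> \<and> B \<omega> \<inter> V = {}}"
    by auto
  then show ?thesis
    by (simp only:) (intro finite_measure_Diff sets_mixed, auto)
qed

lemma sets_window:
  assumes "finite W"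
  shows "{\<omega> \<in> space M. \<Phi> (B \<omega> \<inter> W)} \<in> sets M"
proof -
  have "{\<omega> \<in> space M. \<Phi> (B \<omega> \<inter> W)}
     = (\<Union>S\<in>{S \<in> Pow W. \<Phi> S}. {\<omega> \<in> space M. S \<subseteq> B \<omega> \<and> B \<omega> \<inter> (W - S) = {}})"
  proof (intro set_eqI iffI)
    fix \<omega> assume "\<omega> \<in> (\<Union>S\<in>{S \<in> Pow W. \<Phi> S}. {\<omega> \<in> space M. S \<subseteq> B \<omega> \<and> B \<omega> \<inter> (W - S) = {}})"
    then obtain S where S: "S \<subseteq> W" "\<Phi> S" "\<omega> \<in> space M" "S \<subseteq> B \<omega>" "B \<omega> \<inter> (W - S) = {}" by auto
    then have "B \<omega> \<inter> W = S" by blast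
    with S show "\<omega> \<in> {\<omega> \<in> space M. \<Phi> (B \<omega> \<inter> W)}" by simp
  qed (auto intro!: bexI[of _ "B _ \<inter> W"])
  also have "\<dots> \<in> sets M" using assms by (intro sets.finite_UN sets_mixed) auto
  finally show ?thesis .
qed

lemma expectation_window:
  fixes f :: "site set \<Rightarrow> real"
  assumes "finite W"
  shows "(\<integral>\<omega>. f (B \<omega> \<inter> W) \<partial>M)
    = (\<Sum>S\<in>Pow W. f S * prob {\<omega> \<in> space M. S \<subseteq> B \<omega> \<and> B \<omega> \<inter> (W - S) = {}})"
proof -
  let ?E = "\<lambda>S. {\<omega> \<in> space M. S \<subseteq> B \<omega> \<and> B \<omega> \<inter> (W - S) = {}}"
  have "(\<integral>\<omega>. f (B \<omega> \<inter> W) \<partial>M) = (\<integral>\<omega>. (\<Sum>S\<in>Pow W. f S * indicator (?E S) \<omega>) \<partial>M)"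
  proof (rule Bochner_Integration.integral_cong[OF refl])
    fix \<omega> assume w: "\<omega> \<in> space M"
    have "(\<Sum>S\<in>Pow W. f S * indicator (?E S) \<omega>) = (\<Sum>S\<in>Pow W. if S = B \<omega> \<inter> W then f S else 0)"
      using w by (intro sum.cong) (auto simp: indicator_def)
    also have "\<dots> = f (B \<omega> \<inter> W)" using assms by (subst sum.delta) auto
    finally show "f (B \<omega> \<inter> W) = (\<Sum>S\<in>Pow W. f S * indicator (?E S) \<omega>)" ..
  qed
  also have "\<dots> = (\<Sum>S\<in>Pow W. (\<integral>\<omega>. f S * indicator (?E S) \<omega> \<partial>M))"
    using sets_mixed
    by (intro Bochner_Integration.integral_sum integrable_mult_right integrable_real_indicator)
       (auto simp: less_top[symmetric])
  also have "\<dots> = (\<Sum>S\<in>Pow W. f S * prob (?E S))"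
    using sets_mixed by (intro sum.cong refl) (simp add: Int_def conj_ac)
  finally show ?thesis .
qed

end

text \<open>Two random sets, possibly on different probability spaces, that contain every finite set with the same
probability. Then they have the same law in every finite window.\<close>

locale random_set_pair = R: random_set M B + R': random_set M' B'
  for M :: "'w measure" and B and M' :: "'v measure" and B' +
  assumes same: "\<And>F. finite F \<Longrightarrow>
    measure M {\<omega> \<in> space M. F \<subseteq> B \<omega>} = measure M' {\<omega> \<in> space M'. F \<subseteq> B' \<omega>}"
begin

lemma prob_mixed_eq:
  assumes "finite V" "finite F"
  shows "measure M {\<omega> \<in> space M. F \<subseteq> B \<omega> \<and> B \<omega> \<inter> V = {}}
    = measure M' {\<omega> \<in> space M'. F \<subseteq> B' \<omega> \<and> B' \<omega> \<inter> V = {}}"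
  using assms
proof (induction V arbitrary: F)
  case empty
  then show ?case using same by simp
next
  case (insert v V)
  then show ?case by (simp only: R.prob_mixed_insert R'.prob_mixed_insert finite_insert)
qed

lemma expectation_window_eq:
  fixes f :: "site set \<Rightarrow> real"
  assumes "finite W"
  shows "(\<integral>\<omega>. f (B \<omega> \<inter> W) \<partial>M) = (\<integral>\<omega>. f (B' \<omega> \<inter> W) \<partial>M')"
  unfolding R.expectation_window[OF assms] R'.expectation_window[OF assms]
  by (intro sum.cong refl arg_cong2[where f = "(*)"] prob_mixed_eq)
     (use assms in \<open>auto dest: finite_subset\<close>)

lemma prob_window_eq:
  assumes "finite W"
  shows "measure M {\<omega> \<in> space M. \<Phi> (B \<omega> \<inter> W)} = measure M' {\<omega> \<in> space M'. \<Phi> (B' \<omega> \<inter> W)}"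
proof -
  have "measure M {\<omega> \<in> space M. \<Phi> (B \<omega> \<inter> W)} = (\<integral>\<omega>. indicator {\<omega> \<in> space M. \<Phi> (B \<omega> \<inter> W)} \<omega> \<partial>M)"
    using R.sets_window[OF assms] by (simp add: Int_def conj_ac)
  also have "\<dots> = (\<integral>\<omega>. indicator {S. \<Phi> S} (B \<omega> \<inter> W) \<partial>M)"
    by (rule Bochner_Integration.integral_cong) (auto simp: indicator_def)
  also have "\<dots> = (\<integral>\<omega>. indicator {S. \<Phi> S} (B' \<omega> \<inter> W) \<partial>M')"
    by (rule expectation_window_eq[OF assms])
  also have "\<dots> = (\<integral>\<omega>. indicator {\<omega> \<in> space M'. \<Phi> (B' \<omega> \<inter> W)} \<omega> \<partial>M')"
    by (rule Bochner_Integration.integral_cong) (auto simp: indicator_def)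
  also have "\<dots> = measure M' {\<omega> \<in> space M'. \<Phi> (B' \<omega> \<inter> W)}"
    using R'.sets_window[OF assms] by (simp add: Int_def conj_ac)
  finally show ?thesis .
qed

end

context random_growth
begin

text \<open>What remains of the conditional law of one step after taking expectations. It is stable under
translation and already determines the law at each fixed time.\<close>

definition one_step_law :: "'w measure \<Rightarrow> site set \<Rightarrow> (nat \<Rightarrow> 'w \<Rightarrow> site set) \<Rightarrow> bool" where
  "one_step_law M A0 A \<longleftrightarrow> prob_space M \<and> (\<forall>t x. {\<omega> \<in> space M. x \<in> A t \<omega>} \<in> sets M) \<and>
     (AE \<omega> in M. A 0 \<omega> = A0) \<and>
     (\<forall>t F. finite F \<longrightarrow>
        measure M {\<omega> \<in> space M. F \<subseteq> A (Suc t) \<omega>} = (\<integral>\<omega>. (\<Prod>x\<in>F. occ (A t \<omega>) x) \<partial>M))"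

lemma one_step_law_random_set: "one_step_law M A0 A \<Longrightarrow> random_set M (A t)"
  by (simp add: one_step_law_def random_set_def random_set_axioms_def)

lemma history_subalgebra:
  assumes "\<And>t x. {\<omega> \<in> space M. x \<in> A t \<omega>} \<in> sets M"
  shows "subalgebra M (history M A t)"
  unfolding subalgebra_def history_def
  using assms by (auto simp: space_measure_of_conv sets_measure_of_conv intro!: sets.sigma_sets_subset)

lemma growth_process_one_step_law:
  assumes g: "growth_process M N \<pi> A0 A"
  shows "one_step_law M A0 A"
proof -
  have ps: "prob_space M" and m: "\<And>t x. {\<omega> \<in> space M. x \<in> A t \<omega>} \<in> sets M"
    and c: "\<And>t F. finite F \<Longrightarrow> AE \<omega> in M.
           real_cond_exp M (history M A t) (indicator {\<omega> \<in> space M. F \<subseteq> A (Suc t) \<omega>}) \<omega>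
           = (\<Prod>x\<in>F. occ (A t \<omega>) x)"
    using g by (auto simp: growth_process_def)
  interpret prob_space M by (rule ps)
  have "measure M {\<omega> \<in> space M. F \<subseteq> A (Suc t) \<omega>} = (\<integral>\<omega>. (\<Prod>x\<in>F. occ (A t \<omega>) x) \<partial>M)"
    if F: "finite F" for t F
  proof -
    interpret H: finite_measure_subalgebra M "history M A t"
      by unfold_locales (rule history_subalgebra[OF m])
    let ?E = "{\<omega> \<in> space M. F \<subseteq> A (Suc t) \<omega>}"
    have E: "?E \<in> sets M" by (rule sets_subset_event[OF m])
    have [measurable]: "(\<lambda>\<omega>. occ (A t \<omega>) x) \<in> borel_measurable M" for x
      by (rule occ_measurable[OF m])
    have i: "integrable M (indicator ?E :: _ \<Rightarrow> real)"
      using E by (simp add: less_top[symmetric])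
    have "measure M ?E = (\<integral>\<omega>. indicator ?E \<omega> \<partial>M)" using E by (simp add: Int_def conj_ac)
    also have "\<dots> = (\<integral>\<omega>. real_cond_exp M (history M A t) (indicator ?E) \<omega> \<partial>M)"
      by (rule H.real_cond_exp_int(2)[OF i, symmetric])
    also have "\<dots> = (\<integral>\<omega>. (\<Prod>x\<in>F. occ (A t \<omega>) x) \<partial>M)"
      by (rule integral_cong_AE) (use c[OF F, of t] in auto)
    finally show ?thesis .
  qed
  then show ?thesis using g by (simp add: one_step_law_def growth_process_def)
qed

lemma X_one_step_law: "one_step_law env A (\<lambda>t \<omega>. X t A \<omega>)"
  unfolding one_step_law_def
proof (intro conjI allI impI)
  fix t and F :: "site set" assume "finite F"
  then show "measure env {\<omega> \<in> space env. F \<subseteq> X (Suc t) A \<omega>} = (\<integral>\<omega>. (\<Prod>x\<in>F. occ (X t A \<omega>) x) \<partial>env)"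
    using markov[of t 1 A F] unfolding hit_one_step[OF \<open>finite F\<close>] by (simp add: hit_def)
qed (use X_measurable in \<open>auto intro: env.P.prob_space_axioms\<close>)

lemma mem_translate: "x \<in> (+) z ` A \<longleftrightarrow> x - z \<in> A" for x z :: site
  using image_eqI[of x "(+) z" "x - z" A] by auto

lemma occ_translate: "occ ((+) z ` A) x = occ A (x - z)"
proof -
  have "local_config N ((+) z ` A) x = local_config N A (x - z)"
    by (simp add: local_config_def mem_translate diff_add_eq)
  then show ?thesis by simp
qed

lemma one_step_law_translate:
  assumes "one_step_law M A0 A"
  shows "one_step_law M ((+) z ` A0) (\<lambda>t \<omega>. (+) z ` A t \<omega>)"
  unfolding one_step_law_def
proof (intro conjI allI impI)
  show "prob_space M" using assms by (simp add: one_step_law_def)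
  show "{\<omega> \<in> space M. x \<in> (+) z ` A t \<omega>} \<in> sets M" for t x
    unfolding mem_translate using assms unfolding one_step_law_def by blast
  show "AE \<omega> in M. (+) z ` A 0 \<omega> = (+) z ` A0"
    using assms unfolding one_step_law_def by auto
  fix t and F :: "site set" assume F: "finite F"
  let ?F = "(\<lambda>x. x - z) ` F"
  have "F \<subseteq> (+) z ` B \<longleftrightarrow> ?F \<subseteq> B" for B by (auto simp: mem_translate)
  then have "measure M {\<omega> \<in> space M. F \<subseteq> (+) z ` A (Suc t) \<omega>} = measure M {\<omega> \<in> space M. ?F \<subseteq> A (Suc t) \<omega>}"
    by simp
  also have "\<dots> = (\<integral>\<omega>. (\<Prod>x\<in>?F. occ (A t \<omega>) x) \<partial>M)"
    using assms F by (simp add: one_step_law_def)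
  also have "\<dots> = (\<integral>\<omega>. (\<Prod>x\<in>F. occ ((+) z ` A t \<omega>) x) \<partial>M)"
    by (simp add: prod.reindex inj_on_def occ_translate)
  finally show "measure M {\<omega> \<in> space M. F \<subseteq> (+) z ` A (Suc t) \<omega>}
     = (\<integral>\<omega>. (\<Prod>x\<in>F. occ ((+) z ` A t \<omega>) x) \<partial>M)" .
qed

text \<open>By induction on time: the probability of \<open>F \<subseteq> A (Suc t)\<close> is the expectation of a function of
\<open>A t\<close> in the finite window of sites that \<open>F\<close> can see, and the law of \<open>A t\<close> in that window is known from the
induction hypothesis by inclusion-exclusion.\<close>

lemma one_step_law_hit:
  assumes law: "one_step_law M A0 A" and "finite F"
  shows "measure M {\<omega> \<in> space M. F \<subseteq> A t \<omega>} = hit t A0 F"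
  using \<open>finite F\<close>
proof (induction t arbitrary: F)
  case 0
  interpret prob_space M using law by (simp add: one_step_law_def)
  have ae: "AE \<omega> in M. A 0 \<omega> = A0" using law by (simp add: one_step_law_def)
  have "measure M {\<omega> \<in> space M. F \<subseteq> A 0 \<omega>} = measure M {\<omega> \<in> space M. F \<subseteq> A0}"
    by (rule finite_measure_eq_AE) (use ae law in \<open>auto intro: sets_subset_event simp: one_step_law_def\<close>)
  also have "\<dots> = hit 0 A0 F"
    by (cases "F \<subseteq> A0") (auto simp: hit_def prob_space env.P.prob_space)
  finally show ?case .
next
  case (Suc t)
  interpret random_set_pair M "A t" env "X t A0"
    unfolding random_set_pair_def random_set_pair_axioms_def
    using one_step_law_random_set[OF law] one_step_law_random_set[OF X_one_step_law] Suc.IH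
    by (auto simp: hit_def)
  \<comment> \<open>The sites that F can see.\<close>
  define W where "W = (\<Union>x\<in>F. (+) x ` N)"
  have W: "finite W" using Suc.prems by (auto simp: W_def)
  define f where "f S = (\<Prod>x\<in>F. occ S x)" for S
  have f: "f S = f (S \<inter> W)" for S
    unfolding f_def
    by (intro prod.cong refl arg_cong[where f = \<pi>]) (auto simp: local_config_def W_def)
  have "measure M {\<omega> \<in> space M. F \<subseteq> A (Suc t) \<omega>} = (\<integral>\<omega>. f (A t \<omega>) \<partial>M)"
    using law Suc.prems by (simp add: one_step_law_def f_def)
  also have "\<dots> = (\<integral>\<omega>. f (X t A0 \<omega>) \<partial>env)"
    using expectation_window_eq[OF W, of f] by (simp only: f[symmetric])
  also have "\<dots> = hit (Suc t) A0 F"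
    using X_one_step_law[of A0] Suc.prems by (simp add: one_step_law_def f_def hit_def)
  finally show ?case .
qed

lemma one_step_law_window:
  assumes law: "one_step_law M A0 A" and W: "finite W"
  shows "measure M {\<omega> \<in> space M. \<Phi> (A t \<omega> \<inter> W)} = measure env {\<omega> \<in> space env. \<Phi> (X t A0 \<omega> \<inter> W)}"
proof -
  interpret random_set_pair M "A t" env "X t A0"
    unfolding random_set_pair_def random_set_pair_axioms_def
    using one_step_law_random_set[OF law] one_step_law_random_set[OF X_one_step_law]
      one_step_law_hit[OF law] by (auto simp: hit_def)
  show ?thesis by (rule prob_window_eq[OF W])
qed

text \<open>A translated copy of the process obeys the same one-step law, so uniqueness yields translation
invariance.\<close>

lemma hit_translate:
  assumes "finite F"
  shows "hit t ((+) z ` A) ((+) z ` F) = hit t A F"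
proof -
  have "hit t ((+) z ` A) ((+) z ` F) = measure env {\<omega> \<in> space env. (+) z ` F \<subseteq> (+) z ` X t A \<omega>}"
    using one_step_law_hit[OF one_step_law_translate[OF X_one_step_law]] assms by simp
  also have "\<dots> = hit t A F" by (simp add: hit_def inj_image_subset_iff)
  finally show ?thesis .
qed

section \<open>The law on the space of trajectories\<close>

text \<open>Half-space velocities speak of the coordinate process on trajectories, hence the coupled process has to be
transported there.\<close>

definition traj_law :: "site set \<Rightarrow> (nat \<Rightarrow> site set) measure" where
  "traj_law A = distr env (sigma UNIV {{\<omega>. x \<in> \<omega> t} | x t. True}) (\<lambda>\<omega> t. X t A \<omega>)"

lemma traj_measurable:
  "(\<lambda>\<omega> t. X t A \<omega>) \<in> measurable env (sigma UNIV {{\<omega>. x \<in> \<omega> t} | x t. True})"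
proof (rule measurable_measure_of)
  fix y :: "(nat \<Rightarrow> site set) set" assume "y \<in> {{\<omega>. x \<in> \<omega> t} | x t. True}"
  then obtain x t where y: "y = {\<omega>. x \<in> \<omega> t}" by auto
  have "(\<lambda>\<omega> t. X t A \<omega>) -` y \<inter> space env = {\<omega> \<in> space env. x \<in> X t A \<omega>}" by (auto simp: y)
  then show "(\<lambda>\<omega> t. X t A \<omega>) -` y \<inter> space env \<in> sets env" using X_measurable by simp
qed auto

lemma space_traj_law [simp]: "space (traj_law A) = UNIV"
  by (simp add: traj_law_def space_measure_of_conv)

lemma traj_law_coordinate: "{\<omega> \<in> space (traj_law A). x \<in> \<omega> t} \<in> sets (traj_law A)"
proof -
  have "{\<omega>. x \<in> \<omega> t} \<in> sets (traj_law A)"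
    unfolding traj_law_def sets_distr by (rule in_measure_of) blast+
  then show ?thesis by simp
qed

text \<open>Events of the history up to \<open>t\<close> depend on the first \<open>t\<close> coordinates only, since this is inherited
by complements and countable unions from the generators.\<close>

lemma history_cong:
  assumes "B \<in> sets (history (traj_law A) (\<lambda>t \<omega>. \<omega> t) t)" and "\<And>s. s \<le> t \<Longrightarrow> \<eta> s = \<eta>' s"
  shows "\<eta> \<in> B \<longleftrightarrow> \<eta>' \<in> B"
proof -
  have "B \<in> sigma_sets UNIV {{\<omega>. x \<in> \<omega> s} | s x. s \<le> t}"
    using assms(1) by (simp add: history_def)
  then show ?thesis
    by induction (use assms(2) in auto)
qed

text \<open>For an event \<open>B\<close> of the history up to time \<open>t\<close>, the preimage of \<open>B\<close> in the environment depends on the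
times before \<open>t\<close> only, and the Markov property with one further step is the defining
equation of the conditional expectation.\<close>

lemma growth_process_traj_law: "growth_process (traj_law A) N \<pi> A (\<lambda>t \<omega>. \<omega> t)"
  unfolding growth_process_def
proof (intro conjI allI impI)
  let ?M = "traj_law A" and ?\<tau> = "\<lambda>\<omega> t. X t A \<omega>"
  show ps: "prob_space ?M"
    unfolding traj_law_def by (rule env.P.prob_space_distr[OF traj_measurable])
  interpret prob_space ?M by (rule ps)
  show m: "{\<omega> \<in> space ?M. x \<in> \<omega> t} \<in> sets ?M" for t x by (rule traj_law_coordinate)
  have \<tau>: "?\<tau> \<in> measurable env ?M" using traj_measurable by (simp add: traj_law_def)
  have ae: "(AE \<eta> in ?M. P \<eta>) \<longleftrightarrow> (AE \<omega> in env. P (?\<tau> \<omega>))" if "{\<eta> \<in> space ?M. P \<eta>} \<in> sets ?M" for P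
    unfolding traj_law_def
    by (rule AE_distr_iff[OF traj_measurable]) (use that in \<open>simp add: traj_law_def\<close>)
  show "AE \<eta> in ?M. \<eta> 0 = A"
  proof (subst ae)
    have "{\<eta> \<in> space ?M. \<eta> 0 = A} = {\<eta> \<in> space ?M. A \<subseteq> \<eta> 0 \<and> \<eta> 0 \<inter> - A = {}}" by auto
    also have "\<dots> \<in> sets ?M"
      by (intro sets.sets_Collect_conj sets_subset_event sets_avoid_event m)
    finally show "{\<eta> \<in> space ?M. \<eta> 0 = A} \<in> sets ?M" .
  qed simp
  fix t and F :: "site set" assume F: "finite F"
  let ?H = "history ?M (\<lambda>t \<omega>. \<omega> t) t"
  interpret H: finite_measure_subalgebra ?M ?H
    by unfold_locales (rule history_subalgebra[OF m])
  have Hgen: "{\<omega> \<in> space ?H. x \<in> \<omega> t} \<in> sets ?H" for x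
  proof -
    have "{\<omega>. x \<in> \<omega> t} \<in> sets ?H"
      unfolding history_def space_traj_law by (rule in_measure_of) blast+
    then show ?thesis by (simp add: history_def space_measure_of_conv)
  qed
  let ?E = "{\<eta> \<in> space ?M. F \<subseteq> \<eta> (Suc t)}"
  let ?g = "\<lambda>\<eta>. \<Prod>x\<in>F. occ (\<eta> t) x"
  have E: "?E \<in> sets ?M" by (rule sets_subset_event[OF m])
  have gH: "?g \<in> borel_measurable ?H"
    by (intro borel_measurable_prod occ_measurable Hgen)
  have g: "?g \<in> borel_measurable ?M"
    by (intro borel_measurable_prod occ_measurable m)
  have g01: "0 \<le> ?g \<eta>" "?g \<eta> \<le> 1" for \<eta>
    by (auto intro!: prod_nonneg prod_le_1 simp: occ_bounds)
  show "AE \<eta> in ?M. real_cond_exp ?M ?H (indicator ?E) \<eta> = ?g \<eta>"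
  proof (rule H.real_cond_exp_charact)
    fix B assume B: "B \<in> sets ?H"
    have BM: "B \<in> sets ?M" using B H.subalg by (auto simp: subalgebra_def)
    have bg: "(\<lambda>\<eta>. indicator B \<eta> * ?g \<eta>) \<in> borel_measurable ?M"
      using BM g by (intro borel_measurable_times borel_measurable_indicator)
    let ?B = "?\<tau> -` B \<inter> space env"
    have Be: "?B \<in> sets env" by (rule measurable_sets[OF \<tau> BM])
    have past: "\<omega>' \<in> ?B" if "\<omega> \<in> space env" "\<omega>' \<in> space env" "\<And>s. s < t \<Longrightarrow> \<omega> s = \<omega>' s" "\<omega> \<in> ?B" for \<omega> \<omega>'
    proof -
      have "X s A \<omega> = X s A \<omega>'" if "s \<le> t" for s
        using \<open>\<And>s. s < t \<Longrightarrow> \<omega> s = \<omega>' s\<close> that by (intro X_cong_env) auto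
      then show ?thesis using that history_cong[OF B, of "?\<tau> \<omega>" "?\<tau> \<omega>'"] by auto
    qed
    have "(\<integral>\<eta>\<in>B. indicator ?E \<eta> \<partial>?M) = (\<integral>\<eta>. indicator (B \<inter> ?E) \<eta> \<partial>?M)"
      by (auto simp: set_lebesgue_integral_def indicator_def intro!: Bochner_Integration.integral_cong)
    also have "\<dots> = measure ?M (B \<inter> ?E)" using BM E by simp
    also have "\<dots> = measure env (?\<tau> -` (B \<inter> ?E) \<inter> space env)"
      using measure_distr[OF traj_measurable, of "B \<inter> ?E" A] sets.Int[OF BM E]
      by (simp only: traj_law_def sets_distr)
    also have "?\<tau> -` (B \<inter> ?E) \<inter> space env = ?B \<inter> {\<omega> \<in> space env. F \<subseteq> X (t + 1) A \<omega>}"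
      by auto
    also have "measure env \<dots> = (\<integral>\<omega>. indicator ?B \<omega> * hit 1 (X t A \<omega>) F \<partial>env)"
      by (rule markov_past[OF Be past])
    also have "\<dots> = (\<integral>\<omega>. indicator B (?\<tau> \<omega>) * ?g (?\<tau> \<omega>) \<partial>env)"
      by (rule Bochner_Integration.integral_cong[OF refl]) (simp only: hit_one_step[OF F], simp add: indicator_def)
    also have "\<dots> = (\<integral>\<eta>. indicator B \<eta> * ?g \<eta> \<partial>?M)"
      unfolding traj_law_def
      by (rule integral_distr[OF traj_measurable, symmetric])
         (use bg in \<open>simp only: traj_law_def measurable_distr_eq1\<close>)
    also have "\<dots> = (\<integral>\<eta>\<in>B. ?g \<eta> \<partial>?M)" by (simp add: set_lebesgue_integral_def)
    finally show "(\<integral>\<eta>\<in>B. indicator ?E \<eta> \<partial>?M) = (\<integral>\<eta>\<in>B. ?g \<eta> \<partial>?M)" .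
  next
    show "integrable ?M (indicator ?E :: _ \<Rightarrow> real)" using E by (simp add: less_top[symmetric])
    show "integrable ?M ?g" using g g01 by (intro integrable_const_bound[where B=1]) auto
  qed (rule gH)
qed

end

section \<open>The lattice in the plane\<close>

lemma emb_add: "emb (x + y) = emb x + emb y"
  and emb_diff: "emb (x - y) = emb x - emb y"
  and emb_zero [simp]: "emb 0 = 0"
  by (simp_all add: emb_def prod_eq_iff)

lemma norm_plane_le: "norm (p :: plane) \<le> \<bar>fst p\<bar> + \<bar>snd p\<bar>"
  by (simp add: norm_prod_def sqrt_sum_squares_le_sum_abs)

lemma lattice_ball_subset: "{x. norm (emb x) \<le> r} \<subseteq> {-\<lceil>r\<rceil>..\<lceil>r\<rceil>} \<times> {-\<lceil>r\<rceil>..\<lceil>r\<rceil>}"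
proof clarify
  fix a b assume r: "norm (emb (a, b)) \<le> r"
  have "norm (real_of_int a) \<le> norm (emb (a, b))" "norm (real_of_int b) \<le> norm (emb (a, b))"
    unfolding emb_def fst_conv snd_conv by (rule norm_fst_le norm_snd_le)+
  then have "\<bar>real_of_int a\<bar> \<le> r" "\<bar>real_of_int b\<bar> \<le> r" using r by auto
  then show "a \<in> {-\<lceil>r\<rceil>..\<lceil>r\<rceil>} \<and> b \<in> {-\<lceil>r\<rceil>..\<lceil>r\<rceil>}"
    unfolding atLeastAtMost_iff by linarith
qed

lemma finite_lattice_ball: "finite {x. norm (emb x) \<le> r}"
  by (rule finite_subset[OF lattice_ball_subset]) simp

lemma card_lattice_ball:
  assumes "0 \<le> r"
  shows "real (card {x. norm (emb x) \<le> r}) \<le> (2 * r + 3)\<^sup>2"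
proof -
  have "card {x. norm (emb x) \<le> r} \<le> card ({-\<lceil>r\<rceil>..\<lceil>r\<rceil>} \<times> {-\<lceil>r\<rceil>..\<lceil>r\<rceil>})"
    by (intro card_mono lattice_ball_subset) auto
  also have "\<dots> = nat (2 * \<lceil>r\<rceil> + 1) ^ 2"
    by (simp add: power2_eq_square)
  finally have "real (card {x. norm (emb x) \<le> r}) \<le> real (nat (2 * \<lceil>r\<rceil> + 1) ^ 2)"
    by (simp only: of_nat_le_iff)
  also have "\<dots> = real (nat (2 * \<lceil>r\<rceil> + 1)) ^ 2" by simp
  also have "\<dots> \<le> (2 * r + 3) ^ 2"
    using assms by (intro power_mono) (linarith, simp)
  finally show ?thesis .
qed

lemma lattice_near: "\<exists>z. norm (emb z - p) \<le> 1"
proof -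
  let ?z = "(round (fst p), round (snd p))"
  have "\<bar>fst (emb ?z - p)\<bar> \<le> 1/2" "\<bar>snd (emb ?z - p)\<bar> \<le> 1/2"
    using of_int_round_abs_le[of "fst p"] of_int_round_abs_le[of "snd p"]
    by (simp_all add: emb_def)
  with norm_plane_le[of "emb ?z - p"] have "norm (emb ?z - p) \<le> 1" by linarith
  then show ?thesis ..
qed

lemma inner_unit_le: "norm u = 1 \<Longrightarrow> \<bar>p \<bullet> u\<bar> \<le> norm p" for p u :: plane
  using Cauchy_Schwarz_ineq2[of p u] by simp

definition lattice_half :: "plane \<Rightarrow> real \<Rightarrow> site set" where
  "lattice_half u h = {x. emb x \<bullet> u \<le> h}"

lemma shifted_half_space_iff:
  assumes "norm u = 1"
  shows "p \<in> (+) (a *\<^sub>R u) ` half_space u \<longleftrightarrow> p \<bullet> u \<le> a"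
proof -
  have uu: "u \<bullet> u = 1" using assms by (simp add: dot_square_norm)
  show ?thesis
  proof
    assume "p \<in> (+) (a *\<^sub>R u) ` half_space u"
    then show "p \<bullet> u \<le> a" using uu by (auto simp: half_space_def inner_simps)
  next
    assume "p \<bullet> u \<le> a"
    then show "p \<in> (+) (a *\<^sub>R u) ` half_space u"
      using uu by (intro image_eqI[of _ _ "p - a *\<^sub>R u"]) (auto simp: half_space_def inner_simps)
  qed
qed

context random_growth
begin

section \<open>Finite speed of propagation\<close>

definition reach :: real where
  "reach = (\<Sum>y\<in>N. norm (emb y))"

lemma reach_nonneg: "0 \<le> reach"
  by (simp add: reach_def sum_nonneg)

lemma norm_le_reach: "y \<in> N \<Longrightarrow> norm (emb y) \<le> reach"
  using member_le_sum[of y N "\<lambda>y. norm (emb y)"] by (simp add: reach_def)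

text \<open>Information travels at most the distance \<open>reach\<close> per step, for the same environment. This is what
allows a half-space to be replaced by a set that agrees with it near \<open>x\<close>.\<close>

lemma X_local:
  assumes "x \<in> X t A \<omega>" and "\<And>y. y \<in> A \<Longrightarrow> norm (emb y - emb x) \<le> reach * real t \<Longrightarrow> y \<in> B"
  shows "x \<in> X t B \<omega>"
  using assms
proof (induction t arbitrary: x)
  case (Suc t)
  have "x + y \<in> X t B \<omega>" if y: "y \<in> N" "x + y \<in> X t A \<omega>" for y
  proof (rule Suc.IH[OF y(2)])
    fix z assume z: "z \<in> A" "norm (emb z - emb (x + y)) \<le> reach * real t"
    have "norm (emb z - emb x) \<le> norm (emb z - emb (x + y)) + norm (emb y)"
      using norm_triangle_ineq[of "emb z - emb (x + y)" "emb y"] by (simp add: emb_add algebra_simps)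
    also have "\<dots> \<le> reach * real (Suc t)"
      using z(2) norm_le_reach[OF y(1)] by (simp add: algebra_simps)
    finally show "z \<in> B" by (rule Suc.prems(2)[OF z(1)])
  qed
  then have "local_config N (X t A \<omega>) x \<subseteq> local_config N (X t B \<omega>) x"
    by (auto simp: local_config_def)
  then have "occ (X t A \<omega>) x \<le> occ (X t B \<omega>) x"
    using rule config_subset by (auto simp: growth_rule_def)
  with Suc.prems(1) show ?case by simp
qed simp

lemma X_reach:
  assumes "\<omega> \<in> space env" "x \<in> X t A \<omega>"
  shows "\<exists>a\<in>A. norm (emb a - emb x) \<le> reach * real t"
proof (rule ccontr)
  assume "\<not> ?thesis"
  then have "x \<in> X t {} \<omega>" using X_local[OF assms(2), of "{}"] by auto
  moreover have "X t {} \<omega> = {}"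
  proof (induction t)
    case (Suc t)
    have "occ {} z = 0" for z by (rule occ_eq_0) simp
    then show ?case using space_env[OF assms(1), of t] Suc by (auto simp: not_less)
  qed simp
  ultimately show False by simp
qed

lemma hit_local:
  assumes "\<And>y. y \<in> A \<Longrightarrow> norm (emb y - emb x) \<le> reach * real t \<Longrightarrow> y \<in> B"
  shows "hit t A {x} \<le> hit t B {x}"
  unfolding hit_def
  by (intro env.P.finite_measure_mono hit_sets Collect_mono) (use X_local[where x = x and A = A and t = t and B = B] assms in blast)

lemma hit_union_bound:
  assumes "finite F"
  shows "1 - (\<Sum>x\<in>F. 1 - hit t A {x}) \<le> hit t A F"
proof -
  have s: "{\<omega> \<in> space env. \<not> F \<subseteq> X t A \<omega>} \<in> sets env" for F
    by (intro sets.sets_Collect_neg hit_sets)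
  have c: "measure env {\<omega> \<in> space env. \<not> F \<subseteq> X t A \<omega>} = 1 - hit t A F" for F
    unfolding hit_def by (rule env.P.prob_neg) (rule hit_sets)
  have "1 - hit t A F = measure env {\<omega> \<in> space env. \<not> F \<subseteq> X t A \<omega>}" by (simp only: c)
  also have "{\<omega> \<in> space env. \<not> F \<subseteq> X t A \<omega>} = (\<Union>x\<in>F. {\<omega> \<in> space env. \<not> {x} \<subseteq> X t A \<omega>})" by auto
  also have "measure env \<dots> \<le> (\<Sum>x\<in>F. measure env {\<omega> \<in> space env. \<not> {x} \<subseteq> X t A \<omega>})"
    using assms s by (intro env.P.finite_measure_subadditive_finite) blast+
  finally show ?thesis by (simp only: c)
qed

section \<open>Half-space velocities\<close>

text \<open>The event concerns the finitely many sites of a ball, so it has the same probability for the coupled process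
as for the coordinate process.\<close>

lemma half_space_velocity_env:
  assumes u: "norm u = 1" and v: "half_space_velocity N \<pi> u v" and \<epsilon>: "\<epsilon> > 0"
  shows "\<exists>c>0. \<forall>t. 1 - exp (- c * real t) \<le>
    measure env {\<omega> \<in> space env. \<forall>x. norm (emb x) \<le> (real t)\<^sup>2 \<longrightarrow>
       (emb x \<bullet> u \<le> real t * (v - \<epsilon>) \<longrightarrow> x \<in> X t (lattice_half u 0) \<omega>) \<and>
       (x \<in> X t (lattice_half u 0) \<omega> \<longrightarrow> emb x \<bullet> u \<le> real t * (v + \<epsilon>))}"
proof -
  let ?H = "lattice_half u 0"
  have H: "{x. emb x \<in> half_space u} = ?H" by (simp add: lattice_half_def half_space_def)
  have gp: "growth_process (traj_law ?H) N \<pi> {x. emb x \<in> half_space u} (\<lambda>t \<omega>. \<omega> t)"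
    unfolding H by (rule growth_process_traj_law)
  obtain c where c: "c > 0" and *: "\<And>t. measure (traj_law ?H) {\<omega> \<in> space (traj_law ?H). \<forall>x. norm (emb x) \<le> (real t)\<^sup>2 \<longrightarrow>
             (emb x \<bullet> u \<le> real t * (v - \<epsilon>) \<longrightarrow> x \<in> \<omega> t) \<and>
             (x \<in> \<omega> t \<longrightarrow> emb x \<bullet> u \<le> real t * (v + \<epsilon>))}
           \<ge> 1 - exp (- c * real t)"
    using v gp \<epsilon> unfolding half_space_velocity_def shifted_half_space_iff[OF u] by blast
  have "measure (traj_law ?H) {\<omega> \<in> space (traj_law ?H). \<forall>x. norm (emb x) \<le> (real t)\<^sup>2 \<longrightarrow>
             (emb x \<bullet> u \<le> real t * (v - \<epsilon>) \<longrightarrow> x \<in> \<omega> t) \<and>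
             (x \<in> \<omega> t \<longrightarrow> emb x \<bullet> u \<le> real t * (v + \<epsilon>))}
     = measure env {\<omega> \<in> space env. \<forall>x. norm (emb x) \<le> (real t)\<^sup>2 \<longrightarrow>
       (emb x \<bullet> u \<le> real t * (v - \<epsilon>) \<longrightarrow> x \<in> X t ?H \<omega>) \<and>
       (x \<in> X t ?H \<omega> \<longrightarrow> emb x \<bullet> u \<le> real t * (v + \<epsilon>))}" for t
  proof -
    let ?W = "{x. norm (emb x) \<le> (real t)\<^sup>2}"
    let ?\<Phi> = "\<lambda>S. \<forall>x. norm (emb x) \<le> (real t)\<^sup>2 \<longrightarrow>
       (emb x \<bullet> u \<le> real t * (v - \<epsilon>) \<longrightarrow> x \<in> S) \<and> (x \<in> S \<longrightarrow> emb x \<bullet> u \<le> real t * (v + \<epsilon>))"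
    have \<Phi>: "?\<Phi> S = ?\<Phi> (S \<inter> ?W)" for S by auto
    show ?thesis
      using one_step_law_window[OF growth_process_one_step_law[OF growth_process_traj_law[of ?H]]
          finite_lattice_ball[of "(real t)\<^sup>2"], where \<Phi> = ?\<Phi> and t = t]
      unfolding \<Phi>[symmetric] .
  qed
  with c * show ?thesis by auto
qed

lemma half_space_lower:
  assumes u: "norm u = 1" and v: "half_space_velocity N \<pi> u v" and \<epsilon>: "\<epsilon> > 0"
  shows "\<exists>c>0. \<forall>t x. norm (emb x) \<le> (real t)\<^sup>2 \<longrightarrow> emb x \<bullet> u \<le> real t * (v - \<epsilon>) \<longrightarrow>
    1 - exp (- c * real t) \<le> hit t (lattice_half u 0) {x}"
proof -
  obtain c where c: "c > 0" and *: "\<And>t. 1 - exp (- c * real t) \<le>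
    measure env {\<omega> \<in> space env. \<forall>x. norm (emb x) \<le> (real t)\<^sup>2 \<longrightarrow>
       (emb x \<bullet> u \<le> real t * (v - \<epsilon>) \<longrightarrow> x \<in> X t (lattice_half u 0) \<omega>) \<and>
       (x \<in> X t (lattice_half u 0) \<omega> \<longrightarrow> emb x \<bullet> u \<le> real t * (v + \<epsilon>))}"
    using half_space_velocity_env[OF assms] by blast
  have "1 - exp (- c * real t) \<le> hit t (lattice_half u 0) {x}"
    if "norm (emb x) \<le> (real t)\<^sup>2" "emb x \<bullet> u \<le> real t * (v - \<epsilon>)" for t x
    unfolding hit_def
    by (rule order_trans[OF *[of t]], intro env.P.finite_measure_mono hit_sets Collect_mono)
       (use that in blast)
  with c show ?thesis by blast
qed

lemma half_space_upper:
  assumes u: "norm u = 1" and v: "half_space_velocity N \<pi> u v" and \<epsilon>: "\<epsilon> > 0"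
  shows "\<exists>c>0. \<forall>t. measure env {\<omega> \<in> space env. \<exists>x\<in>X t (lattice_half u 0) \<omega>.
     norm (emb x) \<le> (real t)\<^sup>2 \<and> real t * (v + \<epsilon>) < emb x \<bullet> u} \<le> exp (- c * real t)"
proof -
  obtain c where c: "c > 0" and *: "\<And>t. 1 - exp (- c * real t) \<le>
    measure env {\<omega> \<in> space env. \<forall>x. norm (emb x) \<le> (real t)\<^sup>2 \<longrightarrow>
       (emb x \<bullet> u \<le> real t * (v - \<epsilon>) \<longrightarrow> x \<in> X t (lattice_half u 0) \<omega>) \<and>
       (x \<in> X t (lattice_half u 0) \<omega> \<longrightarrow> emb x \<bullet> u \<le> real t * (v + \<epsilon>))}"
    using half_space_velocity_env[OF assms] by blast
  have "measure env {\<omega> \<in> space env. \<exists>x\<in>X t (lattice_half u 0) \<omega>.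
     norm (emb x) \<le> (real t)\<^sup>2 \<and> real t * (v + \<epsilon>) < emb x \<bullet> u} \<le> exp (- c * real t)" for t
  proof -
    let ?Y = "{x. norm (emb x) \<le> (real t)\<^sup>2 \<and> real t * (v + \<epsilon>) < emb x \<bullet> u}"
    have av: "{\<omega> \<in> space env. X t (lattice_half u 0) \<omega> \<inter> ?Y = {}} \<in> sets env"
      by (rule sets_avoid_event) (rule X_measurable)
    have "{\<omega> \<in> space env. \<exists>x\<in>X t (lattice_half u 0) \<omega>.
      norm (emb x) \<le> (real t)\<^sup>2 \<and> real t * (v + \<epsilon>) < emb x \<bullet> u}
      = {\<omega> \<in> space env. \<not> X t (lattice_half u 0) \<omega> \<inter> ?Y = {}}" by blast
    then have "measure env {\<omega> \<in> space env. \<exists>x\<in>X t (lattice_half u 0) \<omega>.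
      norm (emb x) \<le> (real t)\<^sup>2 \<and> real t * (v + \<epsilon>) < emb x \<bullet> u}
      = 1 - measure env {\<omega> \<in> space env. X t (lattice_half u 0) \<omega> \<inter> ?Y = {}}"
      using env.P.prob_neg[OF av] by simp
    also have "\<dots> \<le> 1 - (1 - exp (- c * real t))"
      by (rule diff_left_mono, rule order_trans[OF *[of t]], rule env.P.finite_measure_mono[OF _ av])
        (force simp: not_less[symmetric])
    finally show ?thesis by simp
  qed
  with c show ?thesis by blast
qed

text \<open>A half-plane at an arbitrary real height \<open>h\<close> contains a lattice translate of the standard one, with
a loss of at most \<open>2\<close> in the height. The translation vector is chosen close to \<open>x\<close>, so
that the relative position of \<open>x\<close> stays in the ball of radius \<open>s\<^sup>2\<close> where the velocity estimate is available.
The constant \<open>c\<close> depends neither on \<open>x\<close> nor on \<open>h\<close>.\<close>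

lemma shifted_half_space_lower:
  assumes u: "norm u = 1" and v: "half_space_velocity N \<pi> u v" and \<epsilon>: "\<epsilon> > 0"
  shows "\<exists>c>0. \<forall>\<^sub>F s in sequentially. \<forall>x h. h \<le> emb x \<bullet> u \<longrightarrow> emb x \<bullet> u - h \<le> real s * (v - \<epsilon>) \<longrightarrow>
    1 - exp (- c * real s) \<le> hit s (lattice_half u h) {x}"
proof -
  have "\<epsilon> / 2 > 0" using \<epsilon> by simp
  from half_space_lower[OF u v this] obtain c where c: "c > 0"
    and *: "\<And>t x. norm (emb x) \<le> (real t)\<^sup>2 \<Longrightarrow> emb x \<bullet> u \<le> real t * (v - \<epsilon> / 2) \<Longrightarrow>
      1 - exp (- c * real t) \<le> hit t (lattice_half u 0) {x}" by blast
  have main: "1 - exp (- c * real s) \<le> hit s (lattice_half u h) {x}"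
    if s: "real s \<ge> 4 / \<epsilon>" "real s \<ge> v + 2" "real s \<ge> 1"
      and x: "h \<le> emb x \<bullet> u" "emb x \<bullet> u - h \<le> real s * (v - \<epsilon>)" for s x h
  proof -
    define d where "d = emb x \<bullet> u - h"
    \<comment> \<open>Aiming one unit below the boundary absorbs the rounding error.\<close>
    obtain z where z: "norm (emb z - (emb x - (d + 1) *\<^sub>R u)) \<le> 1"
      using lattice_near by blast
    have uu: "u \<bullet> u = 1" using u by (simp add: dot_square_norm)
    have "\<bar>(emb z - (emb x - (d + 1) *\<^sub>R u)) \<bullet> u\<bar> \<le> 1"
      using inner_unit_le[OF u] z order_trans by blast
    then have zu: "emb z \<bullet> u \<le> h" "h - 2 \<le> emb z \<bullet> u"
      using uu by (auto simp: d_def inner_simps)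
    have 1: "real s * (\<epsilon> / 2) \<ge> 2" using s(1) \<epsilon> by (simp add: field_simps)
    have "norm (emb x - emb z) \<le> norm ((d + 1) *\<^sub>R u) + norm (emb z - (emb x - (d + 1) *\<^sub>R u))"
      using norm_triangle_ineq4[of "(d + 1) *\<^sub>R u" "emb z - (emb x - (d + 1) *\<^sub>R u)"]
      by (simp add: algebra_simps)
    also have "\<dots> \<le> d + 2" using u z x by (simp add: d_def)
    also have "\<dots> \<le> real s * v + 2"
    proof -
      have "real s * (v - \<epsilon>) \<le> real s * v" using \<epsilon> by (intro mult_left_mono) auto
      with x(2) show ?thesis by (simp add: d_def)
    qed
    also have "\<dots> \<le> real s * (v + 2)" using s(3) by (simp add: algebra_simps)
    also have "\<dots> \<le> (real s)\<^sup>2" using s(2,3) by (simp add: power2_eq_square mult_left_mono)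
    finally have nrm: "norm (emb (x - z)) \<le> (real s)\<^sup>2" by (simp add: emb_diff)
    have "emb (x - z) \<bullet> u \<le> d + 2" using zu by (simp add: emb_diff inner_simps d_def)
    also have "\<dots> \<le> real s * (v - \<epsilon> / 2)" using x(2) 1 by (simp add: d_def algebra_simps)
    finally have "1 - exp (- c * real s) \<le> hit s (lattice_half u 0) {x - z}"
      by (rule *[OF nrm])
    also have "\<dots> = hit s ((+) z ` lattice_half u 0) {x}"
      using hit_translate[of "{x - z}" s z] by simp
    also have "\<dots> \<le> hit s (lattice_half u h) {x}"
      using zu by (intro hit_mono) (auto simp: lattice_half_def emb_add inner_simps)
    finally show ?thesis .
  qed
  have "\<forall>\<^sub>F s in sequentially. real s \<ge> 4 / \<epsilon>" "\<forall>\<^sub>F s in sequentially. real s \<ge> v + 2"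
      "\<forall>\<^sub>F s in sequentially. real s \<ge> 1"
    using filterlim_real_sequentially by (auto simp: filterlim_at_top)
  then have "\<forall>\<^sub>F s in sequentially. \<forall>x h. h \<le> emb x \<bullet> u \<longrightarrow> emb x \<bullet> u - h \<le> real s * (v - \<epsilon>) \<longrightarrow>
    1 - exp (- c * real s) \<le> hit s (lattice_half u h) {x}"
    by eventually_elim (use main in blast)
  with c show ?thesis by blast
qed

text \<open>Comparison with a translated half-space that contains \<open>A0\<close>. Finite speed confines the process to a ball of
radius of order \<open>t\<close>, inside the ball of radius \<open>t\<^sup>2\<close> of the velocity estimate for large \<open>t\<close>.
The argument passes to the window of that ball because only the law in finite windows is
the same for \<open>A\<close> and \<open>X\<close>.\<close>

lemma finite_upper:
  assumes u: "norm u = 1" and v: "half_space_velocity N \<pi> u v" and \<epsilon>: "\<epsilon> > 0"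
    and law: "one_step_law M A0 A" and fin: "finite A0"
  shows "\<exists>c>0. \<forall>\<^sub>F t in sequentially.
    measure M {\<omega> \<in> space M. \<exists>x\<in>A t \<omega>. real t * (v + \<epsilon>) < emb x \<bullet> u} \<le> exp (- c * real t)"
proof -
  let ?H = "lattice_half u 0"
  have "\<epsilon> / 2 > 0" using \<epsilon> by simp
  from half_space_upper[OF u v this] obtain c where c: "c > 0"
    and *: "\<And>t. measure env {\<omega> \<in> space env. \<exists>x\<in>X t ?H \<omega>.
     norm (emb x) \<le> (real t)\<^sup>2 \<and> real t * (v + \<epsilon> / 2) < emb x \<bullet> u} \<le> exp (- c * real t)" by blast
  define \<rho> where "\<rho> = (\<Sum>a\<in>A0. norm (emb a))"
  have \<rho>: "norm (emb a) \<le> \<rho>" if "a \<in> A0" for a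
    unfolding \<rho>_def using fin that by (intro member_le_sum) auto
  have \<rho>0: "0 \<le> \<rho>" by (simp add: \<rho>_def sum_nonneg)
  \<comment> \<open>Far enough in direction u for the translated half-space to contain A0.\<close>
  obtain z where z: "norm (emb z - (\<rho> + 1) *\<^sub>R u) \<le> 1" using lattice_near by blast
  have uu: "u \<bullet> u = 1" using u by (simp add: dot_square_norm)
  have "\<bar>(emb z - (\<rho> + 1) *\<^sub>R u) \<bullet> u\<bar> \<le> 1"
    using inner_unit_le[OF u] z order_trans by blast
  then have zu: "\<rho> \<le> emb z \<bullet> u" "emb z \<bullet> u \<le> \<rho> + 2" using uu by (auto simp: inner_simps)
  have zn: "norm (emb z) \<le> \<rho> + 2"
    using norm_triangle_ineq[of "emb z - (\<rho> + 1) *\<^sub>R u" "(\<rho> + 1) *\<^sub>R u"] z u \<rho>0 by simp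
  have sub: "A0 \<subseteq> (+) z ` ?H"
  proof
    fix a assume a: "a \<in> A0"
    have "emb a \<bullet> u \<le> \<rho>" using inner_unit_le[OF u, of "emb a"] \<rho>[OF a] by linarith
    then show "a \<in> (+) z ` ?H" using zu by (simp add: mem_translate lattice_half_def emb_diff inner_simps)
  qed
  interpret M: random_set M "A t" for t by (rule one_step_law_random_set[OF law])
  have main: "measure M {\<omega> \<in> space M. \<exists>x\<in>A t \<omega>. real t * (v + \<epsilon>) < emb x \<bullet> u} \<le> exp (- c * real t)"
    if t: "real t \<ge> reach + 2 * \<rho> + 2" "real t \<ge> (2 * \<rho> + 4) / \<epsilon>" "real t \<ge> 1" for t
  proof -
    define W where "W = {x. norm (emb x) \<le> reach * real t + \<rho>}"
    have W: "finite W" unfolding W_def by (rule finite_lattice_ball)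
    let ?\<Phi> = "\<lambda>S. \<exists>x\<in>S. real t * (v + \<epsilon>) < emb x \<bullet> u"
    have far: "hit t A0 {x} = 0" if "x \<notin> W" for x
    proof -
      have "{\<omega> \<in> space env. {x} \<subseteq> X t A0 \<omega>} = {}"
      proof (auto)
        fix \<omega> assume "\<omega> \<in> space env" "x \<in> X t A0 \<omega>"
        from X_reach[OF this] obtain a where a: "a \<in> A0" "norm (emb a - emb x) \<le> reach * real t" by blast
        have "norm (emb x) \<le> reach * real t + \<rho>"
          using norm_triangle_ineq4[of "emb a" "emb a - emb x"] a \<rho>[OF a(1)] by simp
        then show False using that by (simp add: W_def)
      qed
      then show ?thesis by (simp only: hit_def measure_empty)
    qed
    have "AE \<omega> in M. \<forall>x\<in>-W. x \<notin> A t \<omega>"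
    proof (subst AE_ball_countable)
      show "\<forall>x\<in>-W. AE \<omega> in M. x \<notin> A t \<omega>"
      proof
        fix x assume "x \<in> - W"
        then have "M.prob {\<omega> \<in> space M. {x} \<subseteq> A t \<omega>} = 0"
          using one_step_law_hit[OF law, of "{x}" t] far by simp
        then show "AE \<omega> in M. x \<notin> A t \<omega>"
          using M.meas[of x t] by (subst (asm) M.prob_eq_0) auto
      qed
    qed simp
    then have "M.prob {\<omega> \<in> space M. ?\<Phi> (A t \<omega>)} = M.prob {\<omega> \<in> space M. ?\<Phi> (A t \<omega> \<inter> W)}"
    proof (intro M.finite_measure_eq_AE)
      show "{\<omega> \<in> space M. ?\<Phi> (A t \<omega> \<inter> W)} \<in> M.events" by (rule M.sets_window[OF W])
      have "{\<omega> \<in> space M. ?\<Phi> (A t \<omega>)} = {\<omega> \<in> space M. \<not> A t \<omega> \<inter> {x. real t * (v + \<epsilon>) < emb x \<bullet> u} = {}}"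
        by blast
      also have "\<dots> \<in> M.events" by (intro sets.sets_Collect_neg sets_avoid_event M.meas)
      finally show "{\<omega> \<in> space M. ?\<Phi> (A t \<omega>)} \<in> M.events" .
    qed (auto elim!: eventually_mono)
    also have "\<dots> = measure env {\<omega> \<in> space env. ?\<Phi> (X t A0 \<omega> \<inter> W)}"
      by (rule one_step_law_window[OF law W])
    also have "\<dots> \<le> measure env {\<omega> \<in> space env. ?\<Phi> (X t ((+) z ` ?H) \<omega> \<inter> W)}"
    proof (rule env.P.finite_measure_mono)
      show "{\<omega> \<in> space env. ?\<Phi> (X t ((+) z ` ?H) \<omega> \<inter> W)} \<in> sets env"
        by (rule random_set.sets_window[OF one_step_law_random_set[OF X_one_step_law] W])
    qed (use X_mono[OF sub, of t] in blast)
    also have "\<dots> = measure env {\<omega> \<in> space env. ?\<Phi> ((+) z ` X t ?H \<omega> \<inter> W)}"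
      by (rule one_step_law_window[OF one_step_law_translate[OF X_one_step_law] W, symmetric])
    also have "\<dots> \<le> measure env {\<omega> \<in> space env. \<exists>x\<in>X t ?H \<omega>.
     norm (emb x) \<le> (real t)\<^sup>2 \<and> real t * (v + \<epsilon> / 2) < emb x \<bullet> u}"
    proof (rule env.P.finite_measure_mono)
      let ?Y = "{x. norm (emb x) \<le> (real t)\<^sup>2 \<and> real t * (v + \<epsilon> / 2) < emb x \<bullet> u}"
      have "{\<omega> \<in> space env. \<exists>x\<in>X t ?H \<omega>. norm (emb x) \<le> (real t)\<^sup>2 \<and> real t * (v + \<epsilon> / 2) < emb x \<bullet> u}
        = {\<omega> \<in> space env. \<not> X t ?H \<omega> \<inter> ?Y = {}}" by blast
      also have "\<dots> \<in> sets env"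
        by (intro sets.sets_Collect_neg sets_avoid_event X_measurable)
      finally show "{\<omega> \<in> space env. \<exists>x\<in>X t ?H \<omega>. norm (emb x) \<le> (real t)\<^sup>2 \<and> real t * (v + \<epsilon> / 2) < emb x \<bullet> u} \<in> sets env" .
      show "{\<omega> \<in> space env. ?\<Phi> ((+) z ` X t ?H \<omega> \<inter> W)} \<subseteq>
        {\<omega> \<in> space env. \<exists>x\<in>X t ?H \<omega>. norm (emb x) \<le> (real t)\<^sup>2 \<and> real t * (v + \<epsilon> / 2) < emb x \<bullet> u}"
      proof (rule subsetI)
        fix \<omega> assume "\<omega> \<in> {\<omega> \<in> space env. ?\<Phi> ((+) z ` X t ?H \<omega> \<inter> W)}"
        then obtain y where y: "y \<in> X t ?H \<omega>" "z + y \<in> W" "real t * (v + \<epsilon>) < emb (z + y) \<bullet> u"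
          and w: "\<omega> \<in> space env" by blast
        have "norm (emb y) \<le> norm (emb (z + y)) + norm (emb z)"
          using norm_triangle_ineq4[of "emb (z + y)" "emb z"] by (simp add: emb_add)
        also have "\<dots> \<le> reach * real t + (2 * \<rho> + 2)" using y(2) zn by (simp add: W_def)
        also have "\<dots> \<le> reach * real t + (2 * \<rho> + 2) * real t" using t(3) \<rho>0 by (simp add: mult_le_cancel_left1)
        also have "\<dots> = (reach + 2 * \<rho> + 2) * real t" by (simp add: algebra_simps)
        also have "\<dots> \<le> (real t)\<^sup>2" using t(1,3) by (simp add: power2_eq_square mult_right_mono)
        finally have n: "norm (emb y) \<le> (real t)\<^sup>2" .
        have "real t * \<epsilon> \<ge> 2 * \<rho> + 4" using t(2) \<epsilon> by (simp add: field_simps)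
        then have "real t * (v + \<epsilon> / 2) < emb y \<bullet> u"
          using y(3) zu by (simp add: emb_add inner_simps algebra_simps)
        with y(1) n w show "\<omega> \<in> {\<omega> \<in> space env. \<exists>x\<in>X t ?H \<omega>. norm (emb x) \<le> (real t)\<^sup>2 \<and> real t * (v + \<epsilon> / 2) < emb x \<bullet> u}" by blast
      qed
    qed
    also have "\<dots> \<le> exp (- c * real t)" by (rule *)
    finally show ?thesis .
  qed
  have "\<forall>\<^sub>F t in sequentially. real t \<ge> reach + 2 * \<rho> + 2" "\<forall>\<^sub>F t in sequentially. real t \<ge> (2 * \<rho> + 4) / \<epsilon>"
      "\<forall>\<^sub>F s in sequentially. real s \<ge> 1"
    using filterlim_real_sequentially by (auto simp: filterlim_at_top)
  then have "\<forall>\<^sub>F t in sequentially.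
    measure M {\<omega> \<in> space M. \<exists>x\<in>A t \<omega>. real t * (v + \<epsilon>) < emb x \<bullet> u} \<le> exp (- c * real t)"
    by eventually_elim (use main in blast)
  with c show ?thesis by blast
qed

end

section \<open>Seeds travel at positive speed\<close>

definition l1 :: "site \<Rightarrow> nat" where
  "l1 x = nat (\<bar>fst x\<bar> + \<bar>snd x\<bar>)"

definition unit_steps :: "site set" where
  "unit_steps = {(1, 0), (-1, 0), (0, 1), (0, -1)}"

lemma l1_step:
  assumes "x \<noteq> 0"
  shows "\<exists>e\<in>unit_steps. Suc (l1 (x - e)) = l1 x"
proof -
  obtain a b where x: "x = (a, b)" by (cases x)
  have "a > 0 \<or> a < 0 \<or> b > 0 \<or> b < 0" using assms x by (auto simp: zero_prod_def)
  then show ?thesis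
    by (elim disjE) (simp_all add: x unit_steps_def l1_def nat_eq_iff Suc_nat_eq_nat_zadd1, linarith+)
qed

lemma l1_le_norm: "real (l1 x) \<le> 2 * norm (emb x)"
proof -
  obtain a b where x: "x = (a, b)" by (cases x)
  have "norm (real_of_int a) \<le> norm (emb x)" "norm (real_of_int b) \<le> norm (emb x)"
    unfolding x emb_def fst_conv snd_conv by (rule norm_fst_le norm_snd_le)+
  then show ?thesis by (simp add: l1_def x)
qed

lemma l1_triangle: "l1 (x - y) \<le> l1 x + l1 y"
  by (cases x; cases y) (simp add: l1_def nat_le_iff)

lemma norm_le_l1: "norm (emb x) \<le> real (l1 x)"
  using norm_plane_le[of "emb x"] by (simp add: l1_def emb_def)

lemma unit_step_along:
  assumes "norm (u :: plane) = 1"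
  shows "\<exists>e\<in>unit_steps. 1/2 \<le> emb e \<bullet> u"
proof -
  obtain a b where u: "u = (a, b)" by (cases u)
  have "1 \<le> \<bar>a\<bar> + \<bar>b\<bar>" using norm_plane_le[of u] assms by (simp add: u)
  then have "a \<ge> 1/2 \<or> a \<le> - 1/2 \<or> b \<ge> 1/2 \<or> b \<le> - 1/2" by linarith
  then show ?thesis
    by (elim disjE) (simp_all add: unit_steps_def emb_def u inner_prod_def)
qed

context random_growth
begin

abbreviation CA :: "site set \<Rightarrow> site set" where
  "CA \<equiv> assoc_CA N \<pi>"

lemma CA_iff: "x \<in> CA A \<longleftrightarrow> 0 < occ A x"
  by (auto simp: assoc_CA_def det_rule_def occ_eq_1)

lemma CA_pow_mono: "m \<le> n \<Longrightarrow> (CA ^^ m) A \<subseteq> (CA ^^ n) A"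
  by (rule lift_Suc_mono_le[of "\<lambda>n. (CA ^^ n) A"]) (auto simp: assoc_CA_def)

lemma fills_finite_set:
  assumes "fills_space CA G" "finite F"
  shows "\<exists>n. F \<subseteq> (CA ^^ n) G"
  using assms(2)
proof induction
  case (insert x F)
  then obtain n where n: "F \<subseteq> (CA ^^ n) G" by blast
  obtain m where m: "x \<in> (CA ^^ m) G" using assms(1) by (auto simp: fills_space_def)
  have "insert x F \<subseteq> (CA ^^ max m n) G"
    using n m CA_pow_mono[of m "max m n" G] CA_pow_mono[of n "max m n" G] by auto
  then show ?case ..
qed simp

text \<open>Each site that the deterministic automaton occupies has a positive chance at that step, and only a finite
set of earlier sites matters for \<open>F\<close>.\<close>

lemma hit_CA_pos:
  assumes "finite F" "F \<subseteq> (CA ^^ n) A"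
  shows "0 < hit n A F"
  using assms
proof (induction n arbitrary: F)
  case 0
  then show ?case using hit_self[of F A 0] by simp
next
  case (Suc n)
  \<comment> \<open>The sites of the previous state that are visible from F.\<close>
  define D where "D = (CA ^^ n) A \<inter> (\<Union>x\<in>F. (+) x ` N)"
  have D: "finite D" using Suc.prems by (simp add: D_def)
  have "0 < hit 1 D F"
    unfolding hit_one_step[OF Suc.prems(1)]
  proof (rule prod_pos)
    fix x assume x: "x \<in> F"
    then have "local_config N D x = local_config N ((CA ^^ n) A) x"
      by (auto simp: local_config_def D_def)
    moreover have "0 < occ ((CA ^^ n) A) x"
      using x Suc.prems CA_iff[of x "(CA ^^ n) A"] by auto
    ultimately show "0 < occ D x" by simp
  qed
  moreover have "0 < hit n A D" by (rule Suc.IH[OF D]) (simp add: D_def)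
  ultimately have "0 < hit n A D * hit 1 D F + (1 - hit n A D) * hit 1 {} F"
    using hit_bounds by (intro add_pos_nonneg mult_pos_pos mult_nonneg_nonneg) auto
  also have "\<dots> \<le> hit (n + 1) A F" by (rule hit_concat) simp
  finally show ?case by simp
qed

text \<open>A seed reaches its four neighbouring copies in \<open>n\<close> steps with positive probability; translation invariance
makes this probability the same everywhere. \<open>n\<close> is taken positive since it is used as a divisor.\<close>

lemma seed_step_probability:
  assumes "finite G" "fills_space CA G"
  shows "\<exists>n q. n > 0 \<and> 0 < q \<and> q \<le> 1 \<and>
    (\<forall>y. \<forall>e\<in>unit_steps. q \<le> hit n ((+) y ` G) ((+) (y + e) ` G))"
proof -
  define F where "F = (\<Union>e\<in>unit_steps. (+) e ` G)"
  have F: "finite F" using assms(1) by (simp add: F_def unit_steps_def)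
  obtain n where "F \<subseteq> (CA ^^ n) G" using fills_finite_set[OF assms(2) F] by blast
  from hit_CA_pos[OF F this] have q: "0 < hit n G F" .
  have "hit n G F \<le> hit (Suc n) ((+) y ` G) ((+) (y + e) ` G)" if "e \<in> unit_steps" for y e
  proof -
    have "hit n G F \<le> hit (Suc n) G F" by (rule hit_mono_time) simp
    also have "\<dots> \<le> hit (Suc n) G ((+) e ` G)" using that by (intro hit_mono) (auto simp: F_def)
    also have "\<dots> = hit (Suc n) ((+) y ` G) ((+) y ` (+) e ` G)"
      using assms(1) by (intro hit_translate[symmetric]) simp
    finally show ?thesis by (simp add: image_image add.assoc)
  qed
  then show ?thesis
    using q hit_bounds[of n G F] by (intro exI[of _ "Suc n"] exI[of _ "hit n G F"]) auto
qed

text \<open>Follow a shortest lattice path from \<open>y\<close> to \<open>x\<close>, trying in each block of \<open>n\<close> steps to move the seed one edge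
further; a failure costs a block but leaves the seed in place. The failure probability is
thus at most \<open>P (B < l1 (x - y))\<close> for a binomial \<open>B\<close> with \<open>J\<close> trials and success probability \<open>q\<close>, and the
bound is its exponential Markov estimate at parameter \<open>-1\<close>, proved directly by induction over the blocks.\<close>

lemma seed_travel:
  assumes q: "0 < q" "q \<le> 1"
    and step: "\<And>y e. e \<in> unit_steps \<Longrightarrow> q \<le> hit n ((+) y ` G) ((+) (y + e) ` G)"
  shows "1 - exp (real (l1 (x - y))) * (1 - q * (1 - exp (-1))) ^ J \<le> hit (n * J) ((+) y ` G) ((+) x ` G)"
proof (induction J arbitrary: y)
  case 0
  show ?case
  proof (cases "x = y")
    case False
    have "1 \<le> exp (real (l1 (x - y)))" by simp
    then show ?thesis using hit_bounds(1)[of "n * 0" "(+) y ` G" "(+) x ` G"]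
      unfolding power_0 mult_1_right by linarith
  qed (simp add: hit_self)
next
  case (Suc J)
  let ?\<theta> = "1 - q * (1 - exp (-1)) :: real"
  have e1: "0 < exp (-1 :: real)" "exp (-1) < (1 :: real)" by simp_all
  have "q * (1 - exp (-1)) \<le> 1 * 1" using q e1 by (intro mult_mono) auto
  then have \<theta>: "0 \<le> ?\<theta>" by simp
  show ?case
  proof (cases "x = y")
    case True
    then show ?thesis using \<theta> by (simp add: hit_self)
  next
    case False
    then obtain e where e: "e \<in> unit_steps" "Suc (l1 (x - (y + e))) = l1 (x - y)"
      using l1_step[of "x - y"] by (auto simp: diff_diff_eq)
    let ?r = "hit n ((+) y ` G) ((+) (y + e) ` G)"
    let ?L = "exp (real (l1 (x - y)))"
    have L: "exp (real (l1 (x - (y + e)))) = ?L * exp (-1)"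
      unfolding e(2)[symmetric] by (simp add: exp_add[symmetric])
    have r: "q \<le> ?r" "?r \<le> 1" using step[OF e(1)] hit_bounds by auto
    have "1 - ?L * ?\<theta> ^ Suc J = 1 - (?L * ?\<theta> ^ J) * (1 - q * (1 - exp (-1)))" by simp
    also have "\<dots> \<le> 1 - (?L * ?\<theta> ^ J) * (1 - ?r * (1 - exp (-1)))"
      using r \<theta> by (intro diff_left_mono mult_left_mono mult_right_mono) auto
    also have "\<dots> = ?r * (1 - ?L * exp (-1) * ?\<theta> ^ J) + (1 - ?r) * (1 - ?L * ?\<theta> ^ J)"
      by (simp add: algebra_simps)
    also have "\<dots> \<le> ?r * hit (n * J) ((+) (y + e) ` G) ((+) x ` G) + (1 - ?r) * hit (n * J) ((+) y ` G) ((+) x ` G)"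
      using r q Suc.IH[of y] Suc.IH[of "y + e"] unfolding L
      by (intro add_mono mult_left_mono) auto
    also have "\<dots> \<le> hit (n + n * J) ((+) y ` G) ((+) x ` G)" by (rule hit_concat) simp
    finally show ?thesis by simp
  qed
qed

text \<open>Choosing \<open>\<kappa>\<close> as half of the exponential rate in \<open>seed_travel\<close> makes the path length cost at most half of
the gain from \<open>J\<close> attempts.\<close>

lemma seed_linear_growth:
  assumes "finite G" "fills_space CA G"
  obtains n \<kappa> where "n > 0" "\<kappa> > 0"
    "\<And>J x y. real (l1 (x - y)) \<le> \<kappa> * real J \<Longrightarrow> 1 - exp (- \<kappa> * real J) \<le> hit (n * J) ((+) y ` G) ((+) x ` G)"
proof -
  obtain n q where n: "n > 0" and q: "0 < q" "q \<le> 1"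
    and step: "\<And>y e. e \<in> unit_steps \<Longrightarrow> q \<le> hit n ((+) y ` G) ((+) (y + e) ` G)"
    using seed_step_probability[OF assms] by blast
  let ?\<theta> = "1 - q * (1 - exp (-1)) :: real"
  have e1: "0 < exp (-1 :: real)" "exp (-1) < (1 :: real)" by simp_all
  have "q * (1 - exp (-1)) \<le> 1 * (1 - exp (-1))" using q e1 by (intro mult_right_mono) auto
  also have "\<dots> < 1" using e1 by simp
  finally have \<theta>: "0 < ?\<theta>" by simp
  have \<theta>1: "?\<theta> < 1" using q e1 by simp
  define \<kappa> where "\<kappa> = - ln ?\<theta> / 2"
  have \<kappa>: "\<kappa> > 0" using \<theta> \<theta>1 by (simp add: \<kappa>_def ln_less_zero)
  have pow: "?\<theta> ^ J = exp (- 2 * \<kappa> * real J)" for J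
  proof -
    have "?\<theta> ^ J = exp (ln ?\<theta>) ^ J" using \<theta> by simp
    also have "\<dots> = exp (real J * ln ?\<theta>)" by (rule exp_of_nat_mult[symmetric])
    finally show ?thesis by (simp add: \<kappa>_def mult.commute)
  qed
  have "1 - exp (- \<kappa> * real J) \<le> hit (n * J) ((+) y ` G) ((+) x ` G)"
    if "real (l1 (x - y)) \<le> \<kappa> * real J" for J x y
  proof -
    have "exp (real (l1 (x - y))) * ?\<theta> ^ J \<le> exp (\<kappa> * real J) * exp (- 2 * \<kappa> * real J)"
      unfolding pow using that by (intro mult_right_mono) auto
    also have "\<dots> = exp (- \<kappa> * real J)" by (simp add: exp_add[symmetric])
    finally show ?thesis using seed_travel[OF q step, of x y J] by linarith
  qed
  with n \<kappa> that show thesis by blast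
qed

lemma CA_empty: "CA {} = {}"
proof -
  have "\<not> 0 < occ {} x" for x using occ_eq_0[of x "{}"] by simp
  then show ?thesis using CA_iff by blast
qed

lemma fills_nonempty: "fills_space CA G \<Longrightarrow> G \<noteq> {}"
proof
  assume "fills_space CA G" "G = {}"
  moreover have "(CA ^^ n) {} = {}" for n by (induction n) (simp_all add: CA_empty)
  ultimately show False by (auto simp: fills_space_def)
qed

text \<open>A half-space contains a seed near its boundary, and this seed travels along a coordinate
direction that makes progress of at least \<open>1/2\<close> per edge towards \<open>u\<close>. If \<open>w u\<close> were smaller than a constant determined
by the speed of seeds, the seed would with high probability be where the upper half of the velocity estimate says
that it is with high probability not.\<close>

lemma velocity_bounded_below:
  assumes G: "finite G" "fills_space CA G"
  shows "\<exists>r>0. \<forall>u v. norm u = 1 \<longrightarrow> half_space_velocity N \<pi> u v \<longrightarrow> r \<le> v"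
proof -
  obtain n \<kappa> where n: "n > 0" and \<kappa>: "\<kappa> > 0" and grow:
    "\<And>J x y. real (l1 (x - y)) \<le> \<kappa> * real J \<Longrightarrow> 1 - exp (- \<kappa> * real J) \<le> hit (n * J) ((+) y ` G) ((+) x ` G)"
    by (rule seed_linear_growth[OF G]) blast
  define \<rho> where "\<rho> = (\<Sum>a\<in>G. norm (emb a))"
  have \<rho>: "norm (emb a) \<le> \<rho>" if "a \<in> G" for a
    unfolding \<rho>_def using G(1) that by (intro member_le_sum) auto
  have \<rho>0: "0 \<le> \<rho>" by (simp add: \<rho>_def sum_nonneg)
  obtain g where g: "g \<in> G" using fills_nonempty[OF G(2)] by blast
  define r where "r = \<kappa> / (4 * real n)"
  have r: "r > 0" using \<kappa> n by (simp add: r_def)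
  have "r \<le> v" if u: "norm u = 1" and v: "half_space_velocity N \<pi> u v" for u v
  proof (rule ccontr)
    assume "\<not> r \<le> v"
    then have "r - v > 0" by simp
    from half_space_upper[OF u v this] obtain c where c: "c > 0" and
      *: "\<And>t. measure env {\<omega> \<in> space env. \<exists>x\<in>X t (lattice_half u 0) \<omega>.
        norm (emb x) \<le> (real t)\<^sup>2 \<and> real t * r < emb x \<bullet> u} \<le> exp (- c * real t)"
      by auto
    obtain e where e: "e \<in> unit_steps" "1/2 \<le> emb e \<bullet> u" using unit_step_along[OF u] by blast
    obtain y where y: "norm (emb y - (- (\<rho> + 1)) *\<^sub>R u) \<le> 1" using lattice_near by blast
    have uu: "u \<bullet> u = 1" using u by (simp add: dot_square_norm)
    have "\<bar>(emb y - (- (\<rho> + 1)) *\<^sub>R u) \<bullet> u\<bar> \<le> 1"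
      using inner_unit_le[OF u] y order_trans by blast
    then have yu: "emb y \<bullet> u \<le> - \<rho>" "- \<rho> - 2 \<le> emb y \<bullet> u" using uu by (auto simp: inner_simps)
    have yn: "norm (emb y) \<le> \<rho> + 2"
      using norm_triangle_ineq[of "emb y - (- (\<rho> + 1)) *\<^sub>R u" "(- (\<rho> + 1)) *\<^sub>R u"] y u \<rho>0 by simp
    have sub: "(+) y ` G \<subseteq> lattice_half u 0"
    proof
      fix a assume "a \<in> (+) y ` G"
      then obtain b where b: "b \<in> G" "a = y + b" by auto
      then show "a \<in> lattice_half u 0"
        using inner_unit_le[OF u, of "emb b"] \<rho>[OF b(1)] yu
        by (simp add: lattice_half_def emb_add inner_simps)
    qed
    have main: "1 - exp (- \<kappa> * real J) \<le> exp (- (c * real n) * real J)"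
      if J: "\<kappa> * real J \<ge> 8 * \<rho> + 12" "real J \<ge> 2 * \<rho> + 2 + \<kappa>" "real J \<ge> 1" for J
    proof -
      define m where "m = nat \<lfloor>\<kappa> * real J\<rfloor>"
      have m: "real m \<le> \<kappa> * real J" "\<kappa> * real J - 1 \<le> real m"
        using \<kappa> by (auto simp: m_def)
      \<comment> \<open>The copy that is m edges away from the start.\<close>
      define x where "x = y + (int m * fst e, int m * snd e)"
      have ex: "emb x = emb y + real m *\<^sub>R emb e" by (simp add: x_def emb_def prod_eq_iff)
      have "l1 (x - y) = m" using e(1) by (auto simp: x_def l1_def unit_steps_def)
      then have "1 - exp (- \<kappa> * real J) \<le> hit (n * J) ((+) y ` G) ((+) x ` G)"
        using m by (intro grow) simp
      also have "\<dots> \<le> hit (n * J) (lattice_half u 0) {x + g}"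
        using sub g by (intro hit_mono) auto
      also have "\<dots> \<le> measure env {\<omega> \<in> space env. \<exists>x\<in>X (n * J) (lattice_half u 0) \<omega>.
        norm (emb x) \<le> (real (n * J))\<^sup>2 \<and> real (n * J) * r < emb x \<bullet> u}"
        unfolding hit_def
      proof (rule env.P.finite_measure_mono)
        let ?Y = "{x. norm (emb x) \<le> (real (n * J))\<^sup>2 \<and> real (n * J) * r < emb x \<bullet> u}"
        have "{\<omega> \<in> space env. \<exists>x\<in>X (n * J) (lattice_half u 0) \<omega>. norm (emb x) \<le> (real (n * J))\<^sup>2 \<and> real (n * J) * r < emb x \<bullet> u}
          = {\<omega> \<in> space env. \<not> X (n * J) (lattice_half u 0) \<omega> \<inter> ?Y = {}}" by blast
        also have "\<dots> \<in> sets env"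
          by (intro sets.sets_Collect_neg sets_avoid_event X_measurable)
        finally show "{\<omega> \<in> space env. \<exists>x\<in>X (n * J) (lattice_half u 0) \<omega>. norm (emb x) \<le> (real (n * J))\<^sup>2 \<and> real (n * J) * r < emb x \<bullet> u} \<in> sets env" .
        have "l1 e = 1" using e(1) by (auto simp: l1_def unit_steps_def)
        then have ne: "norm (emb e) \<le> 1" using norm_le_l1[of e] by simp
        have "norm (emb (x + g)) \<le> norm (emb y) + norm (real m *\<^sub>R emb e) + norm (emb g)"
          unfolding emb_add ex by (intro norm_triangle_le add_right_mono norm_triangle_ineq)
        also have "\<dots> \<le> (\<rho> + 2) + real m * 1 + \<rho>"
          using yn ne \<rho>[OF g] by (intro add_mono) (simp_all add: mult_left_le)
        also have "\<dots> \<le> (2 * \<rho> + 2) * real J + \<kappa> * real J"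
        proof -
          have "(2 * \<rho> + 2) * 1 \<le> (2 * \<rho> + 2) * real J"
            using J(3) \<rho>0 by (intro mult_left_mono) auto
          then show ?thesis using m(1) by (simp add: algebra_simps)
        qed
        also have "\<dots> = (2 * \<rho> + 2 + \<kappa>) * real J" by (simp add: algebra_simps)
        also have "\<dots> \<le> real J * real J" using J(2) by (intro mult_right_mono) auto
        also have "\<dots> \<le> (real (n * J))\<^sup>2"
          using n J(3) by (simp add: power2_eq_square mult_mono)
        finally have 1: "norm (emb (x + g)) \<le> (real (n * J))\<^sup>2" .
        have "real (n * J) * r = \<kappa> * real J / 4" using n by (simp add: r_def)
        also have "\<dots> < - \<rho> - 2 + real m * (1/2) - \<rho>" using m(2) J(1) by (simp add: field_simps)
        also have "\<dots> \<le> emb y \<bullet> u + real m * (emb e \<bullet> u) + emb g \<bullet> u"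
          using yu e(2) inner_unit_le[OF u, of "emb g"] \<rho>[OF g]
          by (smt (verit) mult_left_mono of_nat_0_le_iff)
        also have "\<dots> = emb (x + g) \<bullet> u" by (simp add: emb_add ex inner_simps)
        finally have 2: "real (n * J) * r < emb (x + g) \<bullet> u" .
        show "{\<omega> \<in> space env. {x + g} \<subseteq> X (n * J) (lattice_half u 0) \<omega>} \<subseteq>
          {\<omega> \<in> space env. \<exists>x\<in>X (n * J) (lattice_half u 0) \<omega>. norm (emb x) \<le> (real (n * J))\<^sup>2 \<and> real (n * J) * r < emb x \<bullet> u}"
          using 1 2 by blast
      qed
      also have "\<dots> \<le> exp (- c * real (n * J))" by (rule *)
      finally show ?thesis by (simp add: mult_ac)
    qed
    have "filterlim (\<lambda>J. \<kappa> * real J) at_top sequentially"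
      using \<kappa> filterlim_real_sequentially by (simp add: filterlim_tendsto_pos_mult_at_top[OF tendsto_const])
    then have ev1: "\<forall>\<^sub>F J in sequentially. \<kappa> * real J \<ge> 8 * \<rho> + 12" by (auto simp: filterlim_at_top)
    have ev2: "\<forall>\<^sub>F J in sequentially. real J \<ge> 2 * \<rho> + 2 + \<kappa>" "\<forall>\<^sub>F J in sequentially. real J \<ge> 1"
      using filterlim_real_sequentially by (auto simp: filterlim_at_top)
    have lim: "(\<lambda>J. exp (- a * real J)) \<longlonglongrightarrow> 0" if "a > 0" for a
      using that by real_asymp
    have "(\<lambda>J. 1 - exp (- \<kappa> * real J)) \<longlonglongrightarrow> 1 - 0" by (intro tendsto_intros lim \<kappa>)
    moreover have "(\<lambda>J. exp (- (c * real n) * real J)) \<longlonglongrightarrow> 0" using c n by (intro lim) simp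
    moreover have "\<forall>\<^sub>F J in sequentially. 1 - exp (- \<kappa> * real J) \<le> exp (- (c * real n) * real J)"
      using ev1 ev2 by eventually_elim (rule main)
    ultimately have "1 - 0 \<le> (0 :: real)" by (metis tendsto_le[OF sequentially_bot])
    then show False by simp
  qed
  with r show ?thesis by blast
qed

end

section \<open>Growth of droplets\<close>

text \<open>A flat cap at depth \<open>\<kappa> s\<close> below the pole of a ball of radius \<open>\<rho>\<close> has radius of order \<open>sqrt (\<rho> \<kappa> s)\<close>. If \<open>s\<close> is a
small multiple of \<open>\<rho>\<close>, this exceeds \<open>C s\<close>, so points of lateral size \<open>C s\<close> that are below the cap,
but not by more than the order of \<open>s\<close> below the centre, lie in the ball.\<close>

lemma norm_le_of_cap:
  fixes q u :: "'a::real_inner"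
  assumes u: "norm u = 1" and s: "0 \<le> s" "0 \<le> \<kappa>" "0 \<le> B"
    and up: "q \<bullet> u \<le> \<rho> - \<kappa> * s" and low: "- (q \<bullet> u) \<le> B * s"
    and perp: "norm (q - (q \<bullet> u) *\<^sub>R u) \<le> C * s"
    and s1: "s * (\<kappa>\<^sup>2 + C\<^sup>2) \<le> 2 * \<rho> * \<kappa>" and s2: "s * (B + \<kappa>) \<le> \<rho>"
  shows "norm q \<le> \<rho>"
proof -
  have uu: "u \<bullet> u = 1" using u by (simp add: dot_square_norm)
  have "(norm q)\<^sup>2 = (q \<bullet> u)\<^sup>2 + (norm (q - (q \<bullet> u) *\<^sub>R u))\<^sup>2"
    unfolding power2_norm_eq_inner using uu by (simp add: power2_eq_square inner_simps inner_commute algebra_simps)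
  also have "\<dots> \<le> (\<rho> - \<kappa> * s)\<^sup>2 + (C * s)\<^sup>2"
  proof (rule add_mono)
    have "\<bar>q \<bullet> u\<bar> \<le> \<rho> - \<kappa> * s" using up low s2 by (simp add: abs_le_iff algebra_simps)
    then show "(q \<bullet> u)\<^sup>2 \<le> (\<rho> - \<kappa> * s)\<^sup>2" using power_mono[of "\<bar>q \<bullet> u\<bar>" _ 2] by simp
    show "(norm (q - (q \<bullet> u) *\<^sub>R u))\<^sup>2 \<le> (C * s)\<^sup>2" using perp by (intro power_mono) auto
  qed
  also have "\<dots> = \<rho>\<^sup>2 + s * (s * (\<kappa>\<^sup>2 + C\<^sup>2) - 2 * \<rho> * \<kappa>)"
    by (simp add: power2_eq_square algebra_simps)
  also have "\<dots> \<le> \<rho>\<^sup>2" using s s1 by (simp add: mult_nonneg_nonpos)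
  finally have sq: "(norm q)\<^sup>2 \<le> \<rho>\<^sup>2" .
  have "0 \<le> s * (B + \<kappa>)" using s by simp
  with s2 have "0 \<le> \<rho>" by linarith
  with sq show ?thesis by (rule power2_le_imp_le)
qed

lemma norm_perp_le:
  fixes p u :: "'a::real_inner"
  assumes "norm u = 1"
  shows "norm (p - (p \<bullet> u) *\<^sub>R u) \<le> norm (p - a *\<^sub>R u)"
proof (rule power2_le_imp_le)
  have uu: "u \<bullet> u = 1" using assms by (simp add: dot_square_norm)
  have "(norm (p - a *\<^sub>R u))\<^sup>2 = (norm (p - (p \<bullet> u) *\<^sub>R u))\<^sup>2 + (p \<bullet> u - a)\<^sup>2"
    unfolding power2_norm_eq_inner using uu by (simp add: power2_eq_square inner_simps inner_commute algebra_simps)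
  then show "(norm (p - (p \<bullet> u) *\<^sub>R u))\<^sup>2 \<le> (norm (p - a *\<^sub>R u))\<^sup>2" by simp
qed simp

text \<open>The lattice sites of the dilate \<open>R E\<close>, written without dividing by \<open>R\<close>.\<close>

definition grid :: "real \<Rightarrow> plane set \<Rightarrow> site set" where
  "grid R E = {x. \<exists>y\<in>E. emb x = R *\<^sub>R y}"

lemma direction_net:
  assumes "\<eta> > 0"
  obtains U :: "plane set" where "finite U" "\<And>u. u \<in> U \<Longrightarrow> norm u = 1"
    "\<And>u'. norm u' = 1 \<Longrightarrow> \<exists>u\<in>U. norm (u - u') \<le> \<eta>"
proof -
  have "compact (sphere 0 1 :: plane set)" by simp
  then obtain U where U: "finite U" "U \<subseteq> sphere 0 1" "sphere (0::plane) 1 \<subseteq> (\<Union>x\<in>U. ball x \<eta>)"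
    using assms seq_compact_imp_totally_bounded compact_imp_seq_compact by metis
  show thesis
  proof
    show "\<exists>u\<in>U. norm (u - u') \<le> \<eta>" if "norm u' = 1" for u'
      using that U(3) by (force simp: dist_norm)
  qed (use U in auto)
qed

text \<open>A droplet is a union of balls of one radius, so its dilates look flat on small scales wherever they are
approached, and it keeps the margin \<open>\<delta>\<close> from the half-planes that bound the limit shape.\<close>

locale droplet =
  fixes E :: "plane set" and b M \<delta> :: real and w :: "plane \<Rightarrow> real"
  assumes b_pos: "0 < b" and M_pos: "0 < M"
    and balls: "\<And>y. y \<in> E \<Longrightarrow> \<exists>c. y \<in> cball c b \<and> cball c b \<subseteq> E"
    and bounded: "\<And>y. y \<in> E \<Longrightarrow> norm y \<le> M"
    and slow: "\<And>y u. y \<in> E \<Longrightarrow> norm u = 1 \<Longrightarrow> y \<bullet> u \<le> w u - \<delta>"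
    and \<delta>_pos: "0 < \<delta>"
begin

lemma grid_norm: "x \<in> grid R E \<Longrightarrow> 0 \<le> R \<Longrightarrow> norm (emb x) \<le> R * M"
proof -
  assume "x \<in> grid R E" "0 \<le> R"
  then obtain y where y: "y \<in> E" "emb x = R *\<^sub>R y" by (auto simp: grid_def)
  show "norm (emb x) \<le> R * M"
    using \<open>0 \<le> R\<close> bounded[OF y(1)] by (simp add: y(2) mult_left_mono)
qed

lemma grid_finite: "0 \<le> R \<Longrightarrow> finite (grid R E)"
  by (rule finite_subset[OF _ finite_lattice_ball[of "R * M"]]) (use grid_norm in blast)

text \<open>Let \<open>emb x = (R + s) y\<close> with \<open>y\<close> in a ball of \<open>E\<close> with centre \<open>c\<close>, and let \<open>u\<close> be a direction of the net close
to that of \<open>y - c\<close>. The half-plane orthogonal to \<open>u\<close> whose boundary lies \<open>\<delta> s / 2\<close> below the pole of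
the ball \<open>R (cball c b)\<close> is, within distance \<open>K s\<close> of \<open>x\<close>, contained in that ball. In the direction
\<open>u\<close> the site \<open>x\<close> lies above it by at most \<open>s (y \<bullet> u) + \<delta> s / 2\<close>, and \<open>y \<bullet> u \<le> w u - \<delta>\<close>. The error of
the direction is a lateral displacement of at most \<open>R b \<eta> \<le> s\<close>.\<close>

lemma tangent_half_space:
  assumes K: "0 \<le> K" and R: "0 < R" and s: "0 < s" and x: "x \<in> grid (R + s) E"
    and s1: "s * ((\<delta>/2)\<^sup>2 + (K + M + 1)\<^sup>2) \<le> 2 * (R * b) * (\<delta>/2)"
    and s2: "s * ((K + M) + \<delta>/2) \<le> R * b"
    and \<eta>: "\<eta> \<le> 1" "R * b * \<eta> \<le> s"
    and net: "\<And>u'. norm u' = 1 \<Longrightarrow> \<exists>u\<in>U. norm (u - u') \<le> \<eta>"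
    and U: "\<And>u. u \<in> U \<Longrightarrow> norm u = 1"
  shows "\<exists>u\<in>U. \<exists>h. emb x \<bullet> u - h \<le> s * (w u - \<delta>/2) \<and>
    (\<forall>v. emb v \<bullet> u \<le> h \<longrightarrow> norm (emb v - emb x) \<le> K * s \<longrightarrow> v \<in> grid R E)"
proof -
  obtain y where y: "y \<in> E" "emb x = (R + s) *\<^sub>R y" using x by (auto simp: grid_def)
  obtain c where c: "norm (y - c) \<le> b" "cball c b \<subseteq> E"
    using balls[OF y(1)] by (auto simp: dist_norm norm_minus_commute)
  obtain u' where u': "norm u' = 1" "y - c = norm (y - c) *\<^sub>R u'"
  proof (cases "y = c")
    case True
    then show ?thesis using that[of "(1, 0)"] by (simp add: zero_prod_def)
  next
    case False
    then show ?thesis using that[of "(1 / norm (y - c)) *\<^sub>R (y - c)"] by simp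
  qed
  obtain u where u: "u \<in> U" "norm (u - u') \<le> \<eta>" using net[OF u'(1)] by blast
  have nu: "norm u = 1" using U[OF u(1)] .
  then have uu: "u \<bullet> u = 1" by (simp add: dot_square_norm)
  have "(u - u') \<bullet> u \<le> 1" using inner_unit_le[OF nu, of "u - u'"] u(2) \<eta>(1) by linarith
  then have u'u: "0 \<le> u' \<bullet> u" using uu by (simp add: inner_simps)
  have ycu: "0 \<le> (y - c) \<bullet> u" "(y - c) \<bullet> u \<le> b"
    using u'u inner_unit_le[OF nu, of "y - c"] c(1) by (subst u'(2), simp, linarith)
  define h where "h = R * (c \<bullet> u + b) - \<delta>/2 * s"
  have "emb x \<bullet> u - h = R * ((y - c) \<bullet> u - b) + s * (y \<bullet> u) + \<delta>/2 * s"
    by (simp add: y(2) h_def inner_simps algebra_simps)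
  also have "\<dots> \<le> 0 + s * (w u - \<delta>) + \<delta>/2 * s"
  proof -
    have "R * ((y - c) \<bullet> u - b) \<le> 0" using ycu R by (intro mult_nonneg_nonpos) auto
    moreover have "s * (y \<bullet> u) \<le> s * (w u - \<delta>)" using slow[OF y(1) nu] s by (intro mult_left_mono) auto
    ultimately show ?thesis by linarith
  qed
  finally have 1: "emb x \<bullet> u - h \<le> s * (w u - \<delta>/2)" by (simp add: algebra_simps)
  have 2: "v \<in> grid R E" if v: "emb v \<bullet> u \<le> h" "norm (emb v - emb x) \<le> K * s" for v
  proof -
    define q where "q = emb v - R *\<^sub>R c"
    have q: "q = (emb v - emb x) + R *\<^sub>R (y - c) + s *\<^sub>R y"
      by (simp add: q_def y(2) algebra_simps)
    have sy: "norm (s *\<^sub>R y) \<le> M * s" using s bounded[OF y(1)] by simp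
    have "norm q \<le> R * b"
    proof (rule norm_le_of_cap[OF nu, where \<kappa> = "\<delta>/2" and s = s and B = "K + M" and C = "K + M + 1"])
      show "q \<bullet> u \<le> R * b - \<delta>/2 * s" using v(1) by (simp add: q_def h_def inner_simps algebra_simps)
      have "- (q \<bullet> u) = - ((emb v - emb x) \<bullet> u) - R * ((y - c) \<bullet> u) - (s *\<^sub>R y) \<bullet> u"
        by (simp add: q inner_simps)
      also have "\<dots> \<le> K * s - 0 + M * s"
        using inner_unit_le[OF nu, of "emb v - emb x"] v(2) inner_unit_le[OF nu, of "s *\<^sub>R y"] sy
          mult_nonneg_nonneg[of R "(y - c) \<bullet> u"] R ycu(1) by linarith
      finally show "- (q \<bullet> u) \<le> (K + M) * s" by (simp add: algebra_simps)
      let ?a = "R * norm (y - c)"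
      have "norm (q - (q \<bullet> u) *\<^sub>R u) \<le> norm (q - ?a *\<^sub>R u)" by (rule norm_perp_le[OF nu])
      also have "q - ?a *\<^sub>R u = (emb v - emb x) + s *\<^sub>R y + ?a *\<^sub>R (u' - u)"
      proof -
        have "R *\<^sub>R (y - c) = ?a *\<^sub>R u'" by (subst u'(2)) simp
        then show ?thesis unfolding q by (simp add: algebra_simps)
      qed
      also have "norm \<dots> \<le> K * s + M * s + ?a * norm (u' - u)"
        using v(2) sy R by (intro norm_triangle_le add_mono) auto
      also have "?a * norm (u' - u) \<le> R * b * \<eta>"
        using R c(1) u(2) b_pos by (intro mult_mono) (auto simp: norm_minus_commute)
      also have "\<dots> \<le> s" by (rule \<eta>(2))
      finally show "norm (q - (q \<bullet> u) *\<^sub>R u) \<le> (K + M + 1) * s" by (simp add: algebra_simps)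
    qed (use s \<delta>_pos K M_pos s1 s2 in auto)
    then have "norm (emb v /\<^sub>R R - c) \<le> b"
    proof -
      have "emb v /\<^sub>R R - c = q /\<^sub>R R" using R by (simp add: q_def algebra_simps)
      then show ?thesis using \<open>norm q \<le> R * b\<close> R by (simp add: field_simps)
    qed
    then have "emb v /\<^sub>R R \<in> E" using c(2) by (auto simp: dist_norm norm_minus_commute)
    then show ?thesis using R by (auto simp: grid_def intro!: bexI[of _ "emb v /\<^sub>R R"])
  qed
  show ?thesis using u(1) 1 2 by blast
qed

end

context random_growth
begin

lemma shifted_half_space_lower_finite:
  assumes "finite U" and U: "\<And>u. u \<in> U \<Longrightarrow> norm u = 1 \<and> half_space_velocity N \<pi> u (w u)" and \<epsilon>: "\<epsilon> > 0"
  shows "\<exists>c>0. \<forall>\<^sub>F s in sequentially. \<forall>u\<in>U. \<forall>x h. h \<le> emb x \<bullet> u \<longrightarrow> emb x \<bullet> u - h \<le> real s * (w u - \<epsilon>) \<longrightarrow>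
    1 - exp (- c * real s) \<le> hit s (lattice_half u h) {x}"
  using assms(1) U
proof (induction U)
  case empty
  then show ?case by (auto intro: exI[of _ 1])
next
  case (insert u U)
  obtain c where c: "c > 0" and evc: "\<forall>\<^sub>F s in sequentially. \<forall>u\<in>U. \<forall>x h. h \<le> emb x \<bullet> u \<longrightarrow> emb x \<bullet> u - h \<le> real s * (w u - \<epsilon>) \<longrightarrow>
    1 - exp (- c * real s) \<le> hit s (lattice_half u h) {x}" using insert by blast
  obtain d where d: "d > 0" and evd: "\<forall>\<^sub>F s in sequentially. \<forall>x h. h \<le> emb x \<bullet> u \<longrightarrow> emb x \<bullet> u - h \<le> real s * (w u - \<epsilon>) \<longrightarrow>
    1 - exp (- d * real s) \<le> hit s (lattice_half u h) {x}"
    using shifted_half_space_lower[of u "w u" \<epsilon>] insert.prems \<epsilon> by blast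
  have le: "1 - exp (- min c d * real s) \<le> 1 - exp (- c * real s)"
    "1 - exp (- min c d * real s) \<le> 1 - exp (- d * real s)" for s
    by (auto intro: mult_right_mono)
  have "\<forall>\<^sub>F s in sequentially. \<forall>u'\<in>insert u U. \<forall>x h. h \<le> emb x \<bullet> u' \<longrightarrow> emb x \<bullet> u' - h \<le> real s * (w u' - \<epsilon>) \<longrightarrow>
    1 - exp (- min c d * real s) \<le> hit s (lattice_half u' h) {x}"
    using evc evd
  proof eventually_elim
    case (elim s)
    show ?case
    proof (intro ballI allI impI)
      fix u' x h assume u': "u' \<in> insert u U" and h: "h \<le> emb x \<bullet> u'" "emb x \<bullet> u' - h \<le> real s * (w u' - \<epsilon>)"
      show "1 - exp (- min c d * real s) \<le> hit s (lattice_half u' h) {x}"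
      proof (cases "u' = u")
        case True
        show ?thesis by (rule order_trans[OF le(2)]) (use elim(2) h True in blast)
      next
        case False
        show ?thesis by (rule order_trans[OF le(1)]) (use elim(1) h u' False in blast)
      qed
    qed
  qed
  with c d show ?case by (intro exI[of _ "min c d"]) auto
qed

text \<open>Every site of \<open>(R + s) E\<close> is reached from a half-space that is locally contained in \<open>R E\<close>, with a failure
probability that is exponentially small in \<open>s\<close> uniformly over the finite net; the union bound over the sites costs a
polynomial factor. The lower bound \<open>\<alpha> R \<le> s\<close> is needed twice: it lets a fixed net be
fine enough, and it bounds the number of sites by a polynomial in \<open>s\<close>.\<close>

lemma droplet_growth_step:
  assumes "droplet E b M \<delta> w"
    and vel: "\<And>u. norm u = 1 \<Longrightarrow> half_space_velocity N \<pi> u (w u)"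
    and \<delta>: "\<And>u. norm u = 1 \<Longrightarrow> \<delta> \<le> w u"
  shows "\<exists>\<beta>>0. \<forall>\<alpha>>0. \<exists>c>0. \<forall>\<^sub>F s in sequentially. \<forall>R>0. \<alpha> * R \<le> real s \<longrightarrow> real s \<le> \<beta> * R \<longrightarrow>
    1 - exp (- c * real s) \<le> hit s (grid R E) (grid (R + real s) E)"
proof -
  interpret droplet E b M \<delta> w by fact
  define Q where "Q = (\<delta>/2)\<^sup>2 + (reach + M + 1)\<^sup>2"
  note reach0 = reach_nonneg
  have Q: "Q > 0" using \<delta>_pos by (simp add: Q_def add_pos_nonneg)
  have P: "reach + M + \<delta>/2 > 0" using reach0 M_pos \<delta>_pos by linarith
  \<comment> \<open>The two conditions on s / R under which the cap estimate applies.\<close>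
  define \<beta> where "\<beta> = min (b * \<delta> / Q) (b / (reach + M + \<delta>/2))"
  have \<beta>: "\<beta> > 0" using b_pos \<delta>_pos Q P by (simp add: \<beta>_def)
  have "\<exists>c>0. \<forall>\<^sub>F s in sequentially. \<forall>R>0. \<alpha> * R \<le> real s \<longrightarrow> real s \<le> \<beta> * R \<longrightarrow>
    1 - exp (- c * real s) \<le> hit s (grid R E) (grid (R + real s) E)" if \<alpha>: "\<alpha> > 0" for \<alpha>
  proof -
    \<comment> \<open>Mesh of the net: then the lateral error R b \<eta> is at most s.\<close>
    define \<eta> where "\<eta> = min 1 (\<alpha> / b)"
    have \<eta>: "\<eta> > 0" "\<eta> \<le> 1" unfolding \<eta>_def using \<alpha> b_pos by simp_all
    obtain U :: "plane set" where U: "finite U" "\<And>u. u \<in> U \<Longrightarrow> norm u = 1"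
      and net: "\<And>u'. norm u' = 1 \<Longrightarrow> \<exists>u\<in>U. norm (u - u') \<le> \<eta>"
      using direction_net[OF \<eta>(1)] by blast
    have "\<delta>/2 > 0" using \<delta>_pos by simp
    then obtain c where c: "c > 0" and ev: "\<forall>\<^sub>F s in sequentially. \<forall>u\<in>U. \<forall>x h. h \<le> emb x \<bullet> u \<longrightarrow>
        emb x \<bullet> u - h \<le> real s * (w u - \<delta>/2) \<longrightarrow> 1 - exp (- c * real s) \<le> hit s (lattice_half u h) {x}"
      using shifted_half_space_lower_finite[OF U(1), of w "\<delta>/2"] U(2) vel by blast
    define A where "A = 2 * ((1 / \<alpha> + 1) * M)"
    have A: "A > 0" using \<alpha> M_pos by (simp add: A_def add_pos_nonneg)
    have "\<forall>\<^sub>F s in sequentially. (A * real s + 3)\<^sup>2 * exp (- c * real s) \<le> exp (- (c/2) * real s)"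
      using A c by real_asymp
    with ev eventually_gt_at_top[of 0] have "\<forall>\<^sub>F s in sequentially. \<forall>R>0. \<alpha> * R \<le> real s \<longrightarrow> real s \<le> \<beta> * R \<longrightarrow>
      1 - exp (- (c/2) * real s) \<le> hit s (grid R E) (grid (R + real s) E)"
    proof eventually_elim
      case (elim s)
      show ?case
      proof (intro allI impI)
        fix R :: real assume R: "R > 0" "\<alpha> * R \<le> real s" "real s \<le> \<beta> * R"
        have s0: "0 < real s" using elim by simp
        have "\<beta> * R \<le> b * \<delta> / Q * R"
          using R(1) by (intro mult_right_mono) (auto simp: \<beta>_def)
        with R(3) have "real s \<le> b * \<delta> / Q * R" by (rule order_trans)
        then have s1: "real s * ((\<delta>/2)\<^sup>2 + (reach + M + 1)\<^sup>2) \<le> 2 * (R * b) * (\<delta>/2)"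
          using Q unfolding Q_def[symmetric] by (simp add: field_simps)
        have "\<beta> * R \<le> b / (reach + M + \<delta>/2) * R"
          using R(1) by (intro mult_right_mono) (auto simp: \<beta>_def)
        with R(3) have "real s \<le> b / (reach + M + \<delta>/2) * R" by (rule order_trans)
        then have s2: "real s * ((reach + M) + \<delta>/2) \<le> R * b"
          using P by (simp add: field_simps)
        have "R * b * \<eta> \<le> R * b * (\<alpha> / b)"
          using R b_pos by (intro mult_left_mono) (auto simp: \<eta>_def)
        also have "\<dots> \<le> real s" using R b_pos by (simp add: mult.commute)
        finally have \<eta>s: "R * b * \<eta> \<le> real s" .
        have single: "1 - exp (- c * real s) \<le> hit s (grid R E) {x}" if x: "x \<in> grid (R + real s) E" for x
        proof -
          obtain u h where u: "u \<in> U" and h: "emb x \<bullet> u - h \<le> real s * (w u - \<delta>/2)"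
            and sub: "\<And>v. emb v \<bullet> u \<le> h \<Longrightarrow> norm (emb v - emb x) \<le> reach * real s \<Longrightarrow> v \<in> grid R E"
            using tangent_half_space[OF reach0 R(1) s0 x s1 s2 \<eta>(2) \<eta>s net U(2)] by blast
          have "w u - \<delta>/2 \<ge> 0" using \<delta>[OF U(2)[OF u]] \<delta>_pos by simp
          \<comment> \<open>A site already below the height h is covered by lowering the half-plane to it.\<close>
          then have h': "emb x \<bullet> u - min h (emb x \<bullet> u) \<le> real s * (w u - \<delta>/2)"
            using h s0 by (simp add: min_def)
          have "1 - exp (- c * real s) \<le> hit s (lattice_half u (min h (emb x \<bullet> u))) {x}"
            using elim u h' min.cobounded2 by blast
          also have "\<dots> \<le> hit s (grid R E) {x}"
            by (rule hit_local) (use sub in \<open>auto simp: lattice_half_def\<close>)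
          finally show ?thesis .
        qed
        let ?F = "grid (R + real s) E"
        have F: "finite ?F" using R s0 by (intro grid_finite) simp
        have "R \<le> real s / \<alpha>" using R(2) \<alpha> by (simp add: field_simps)
        then have RM: "(R + real s) * M \<le> (1 / \<alpha> + 1) * real s * M"
          using M_pos by (intro mult_right_mono) (auto simp: algebra_simps)
        have "real (card ?F) \<le> real (card {x. norm (emb x) \<le> (R + real s) * M})"
          using R s0 by (intro of_nat_mono card_mono finite_lattice_ball) (use grid_norm[of _ "R + real s"] in auto)
        also have "\<dots> \<le> (2 * ((R + real s) * M) + 3)\<^sup>2"
          using R s0 M_pos by (intro card_lattice_ball) simp
        also have "\<dots> \<le> (A * real s + 3)\<^sup>2"
        proof (rule power_mono)
          have "A * real s = 2 * ((1 / \<alpha> + 1) * real s * M)" by (simp add: A_def)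
          with RM show "2 * ((R + real s) * M) + 3 \<le> A * real s + 3" by linarith
        qed (use R s0 M_pos in simp)
        finally have card: "real (card ?F) \<le> (A * real s + 3)\<^sup>2" .
        have "(\<Sum>x\<in>?F. 1 - hit s (grid R E) {x}) \<le> (\<Sum>x\<in>?F. exp (- c * real s))"
          by (rule sum_mono) (use single in force)
        also have "\<dots> = real (card ?F) * exp (- c * real s)" by simp
        also have "\<dots> \<le> (A * real s + 3)\<^sup>2 * exp (- c * real s)"
          using card by (intro mult_right_mono) auto
        also have "\<dots> \<le> exp (- (c/2) * real s)" using elim by simp
        finally show "1 - exp (- (c/2) * real s) \<le> hit s (grid R E) ?F"
          using hit_union_bound[OF F, of s "grid R E"] by linarith
      qed
    qed
    with c show ?thesis by (intro exI[of _ "c/2"]) auto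
  qed
  with \<beta> show ?thesis by blast
qed

lemma hit_chain:
  assumes "1 - a \<le> hit m A D" "1 - b \<le> hit k D F"
  shows "1 - (a + b) \<le> hit (m + k) A F"
proof -
  have "0 \<le> (1 - hit m A D) * (1 - hit k D F)"
    using hit_bounds by (intro mult_nonneg_nonneg) auto
  then have "1 - (a + b) \<le> hit m A D * hit k D F"
    using assms by (simp add: algebra_simps)
  also have "\<dots> \<le> hit m A D * hit k D F + (1 - hit m A D) * hit k {} F"
    using hit_bounds by simp
  also have "\<dots> \<le> hit (m + k) A F" by (rule hit_concat) simp
  finally show ?thesis .
qed

lemma hit_chain_steps:
  assumes "1 - a \<le> hit m A (D 0)" "\<And>j. j < J \<Longrightarrow> 1 - b \<le> hit s (D j) (D (Suc j))"
  shows "1 - (a + real J * b) \<le> hit (m + J * s) A (D J)"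
  using assms
proof (induction J)
  case (Suc J)
  have "1 - ((a + real J * b) + b) \<le> hit ((m + J * s) + s) A (D (Suc J))"
    by (rule hit_chain[OF Suc.IH]) (use Suc.prems in auto)
  then show ?case by (simp add: algebra_simps)
qed simp

lemma seed_fills_ball:
  assumes G: "finite G" "fills_space CA G" and \<eta>: "\<eta> > 0"
  shows "\<exists>r>0. \<exists>c>0. \<forall>\<^sub>F t in sequentially.
    1 - exp (- c * real t) \<le> hit (nat \<lfloor>\<eta> * real t\<rfloor>) G {x. norm (emb x) \<le> r * real t}"
proof -
  obtain n \<kappa> where n: "n > 0" and \<kappa>: "\<kappa> > 0" and grow:
    "\<And>J x y. real (l1 (x - y)) \<le> \<kappa> * real J \<Longrightarrow> 1 - exp (- \<kappa> * real J) \<le> hit (n * J) ((+) y ` G) ((+) x ` G)"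
    by (rule seed_linear_growth[OF G]) blast
  obtain g where g: "g \<in> G" using fills_nonempty[OF G(2)] by blast
  define r where "r = \<kappa> * \<eta> / (8 * real n)"
  define c where "c = \<kappa> * \<eta> / (2 * real n)"
  have r: "r > 0" and c: "c > 0" using \<kappa> \<eta> n by (auto simp: r_def c_def)
  have "\<forall>\<^sub>F t in sequentially. (2 * (r * real t) + 3)\<^sup>2 * exp (- c * real t) \<le> exp (- (c/2) * real t)"
    using r c by real_asymp
  moreover have "\<forall>\<^sub>F t in sequentially. real t \<ge> 2 * real n / \<eta>"
    "\<forall>\<^sub>F t in sequentially. real t \<ge> real (l1 g) / (2 * r)"
    using filterlim_real_sequentially by (auto simp: filterlim_at_top)
  ultimately have "\<forall>\<^sub>F t in sequentially.
    1 - exp (- (c/2) * real t) \<le> hit (nat \<lfloor>\<eta> * real t\<rfloor>) G {x. norm (emb x) \<le> r * real t}"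
  proof eventually_elim
    case (elim t)
    define J where "J = nat \<lfloor>\<eta> * real t / real n\<rfloor>"
    have J0: "0 \<le> \<eta> * real t / real n" using \<eta> by simp
    then have J: "real J \<le> \<eta> * real t / real n" "\<eta> * real t / real n - 1 \<le> real J"
      unfolding J_def by linarith+
    have "1 \<le> \<eta> * real t / (2 * real n)" using elim(2) \<eta> n by (simp add: field_simps)
    then have J2: "\<eta> * real t / (2 * real n) \<le> real J" using J(2) by (simp add: field_simps)
    have "real (n * J) \<le> \<eta> * real t" using J(1) n by (simp add: field_simps)
    then have nJ: "n * J \<le> nat \<lfloor>\<eta> * real t\<rfloor>" by (simp add: le_nat_floor)
    have \<kappa>J: "c * real t \<le> \<kappa> * real J"
      using mult_left_mono[OF J2, of \<kappa>] \<kappa> by (simp add: c_def field_simps)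
    \<comment> \<open>Half of c t pays for the path to x, the other half for the position of g inside G.\<close>
    have c4: "c = 4 * r" by (simp add: c_def r_def)
    let ?F = "{x. norm (emb x) \<le> r * real t}"
    have single: "1 - exp (- c * real t) \<le> hit (nat \<lfloor>\<eta> * real t\<rfloor>) G {x}" if x: "x \<in> ?F" for x
    proof -
      have "real (l1 ((x - g) - 0)) \<le> real (l1 x) + real (l1 g)" using l1_triangle[of x g] by simp
      also have "\<dots> \<le> 2 * (r * real t) + 2 * (r * real t)"
        using l1_le_norm[of x] x elim(3) r by (simp add: field_simps)
      also have "\<dots> \<le> \<kappa> * real J" using \<kappa>J c4 by simp
      finally have "1 - exp (- \<kappa> * real J) \<le> hit (n * J) ((+) 0 ` G) ((+) (x - g) ` G)" by (rule grow)
      also have "\<dots> \<le> hit (n * J) G {x}" using g by (intro hit_mono) force+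
      also have "\<dots> \<le> hit (nat \<lfloor>\<eta> * real t\<rfloor>) G {x}" by (rule hit_mono_time[OF nJ])
      finally show ?thesis using \<kappa>J by (smt (verit) exp_le_cancel_iff mult_minus_left)
    qed
    have "(\<Sum>x\<in>?F. 1 - hit (nat \<lfloor>\<eta> * real t\<rfloor>) G {x}) \<le> (\<Sum>x\<in>?F. exp (- c * real t))"
      by (rule sum_mono) (use single in force)
    also have "\<dots> = real (card ?F) * exp (- c * real t)" by simp
    also have "\<dots> \<le> (2 * (r * real t) + 3)\<^sup>2 * exp (- c * real t)"
      using r by (intro mult_right_mono card_lattice_ball) auto
    also have "\<dots> \<le> exp (- (c/2) * real t)" by (rule elim(1))
    finally show ?case using hit_union_bound[OF finite_lattice_ball, of "nat \<lfloor>\<eta> * real t\<rfloor>" G "r * real t"] by linarith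
  qed
  with r c show ?thesis by (intro exI[of _ r] exI[of _ "c/2"] conjI) auto
qed

text \<open>The time \<open>t\<close> is split as follows: \<open>\<theta> t / 3\<close> for filling a ball of radius proportional to \<open>t\<close> by seeds, then \<open>J\<close>
droplet steps of length about \<open>\<alpha> t\<close>, where \<open>J\<close> does not depend on \<open>t\<close>. Each step enlarges the dilation factor by its length;
the part of \<open>\<theta>\<close> not used for the ball covers the roundings.\<close>

lemma droplet_linear_growth:
  assumes dr: "droplet E b M \<delta> w"
    and star: "\<And>y l. y \<in> E \<Longrightarrow> 0 \<le> l \<Longrightarrow> l \<le> 1 \<Longrightarrow> l *\<^sub>R y \<in> E"
    and vel: "\<And>u. norm u = 1 \<Longrightarrow> half_space_velocity N \<pi> u (w u)"
    and \<delta>: "\<And>u. norm u = 1 \<Longrightarrow> \<delta> \<le> w u"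
    and G: "finite G" "fills_space CA G" and \<theta>: "0 < \<theta>" "\<theta> < 1"
  shows "\<exists>c>0. \<forall>\<^sub>F t in sequentially. 1 - exp (- c * real t) \<le> hit t G (grid ((1 - \<theta>) * real t) E)"
proof -
  interpret droplet E b M \<delta> w by (rule dr)
  obtain \<beta> where \<beta>: "\<beta> > 0" and step: "\<And>\<alpha>. \<alpha> > 0 \<Longrightarrow> \<exists>c>0. \<forall>\<^sub>F s in sequentially. \<forall>R>0. \<alpha> * R \<le> real s \<longrightarrow> real s \<le> \<beta> * R \<longrightarrow>
    1 - exp (- c * real s) \<le> hit s (grid R E) (grid (R + real s) E)"
    using droplet_growth_step[OF dr vel \<delta>] by blast
  have "\<theta>/3 > 0" using \<theta> by simp
  from seed_fills_ball[OF G this] obtain r c1 where r: "r > 0" and c1: "c1 > 0"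
    and ball: "\<forall>\<^sub>F t in sequentially.
    1 - exp (- c1 * real t) \<le> hit (nat \<lfloor>\<theta>/3 * real t\<rfloor>) G {x. norm (emb x) \<le> r * real t}" by blast
  define \<rho> where "\<rho> = r / M"
  have \<rho>: "\<rho> > 0" using r M_pos by (simp add: \<rho>_def)
  define \<alpha> where "\<alpha> = min (\<beta> * \<rho>) (\<theta>/3)"
  have \<alpha>: "\<alpha> > 0" "\<alpha> \<le> \<beta> * \<rho>" "\<alpha> \<le> \<theta>/3" using \<beta> \<rho> \<theta> by (auto simp: \<alpha>_def)
  define J where "J = nat \<lfloor>(1 - \<theta>/3) / \<alpha>\<rfloor>"
  have "0 \<le> (1 - \<theta>/3) / \<alpha>" using \<theta> \<alpha> by simp
  then have "real J \<le> (1 - \<theta>/3) / \<alpha>" "(1 - \<theta>/3) / \<alpha> - 1 \<le> real J" unfolding J_def by linarith+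
  then have J: "real J * \<alpha> \<le> 1 - \<theta>/3" "1 - \<theta>/3 - \<alpha> \<le> real J * \<alpha>" using \<alpha>(1) by (auto simp: field_simps)
  \<comment> \<open>Lower bound for s / R over all J steps, once s is at least \<alpha> t / 2.\<close>
  define \<alpha>' where "\<alpha>' = (\<alpha>/2) / (\<rho> + real J * \<alpha>)"
  have \<alpha>': "\<alpha>' > 0" using \<alpha> \<rho> by (simp add: \<alpha>'_def add_pos_nonneg)
  from step[OF \<alpha>'] obtain c2 where c2: "c2 > 0" and evs: "\<forall>\<^sub>F s in sequentially. \<forall>R>0. \<alpha>' * R \<le> real s \<longrightarrow> real s \<le> \<beta> * R \<longrightarrow>
    1 - exp (- c2 * real s) \<le> hit s (grid R E) (grid (R + real s) E)" by blast
  have lim: "filterlim (\<lambda>t. nat \<lfloor>\<alpha> * real t\<rfloor>) sequentially sequentially"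
    using \<alpha>(1) by real_asymp
  \<comment> \<open>Strictly below both rates, so that the constant J is absorbed.\<close>
  define c where "c = min c1 (c2 * (\<alpha>/2)) / 2"
  have c: "c > 0" "c < c1" "c < c2 * (\<alpha>/2)" using c1 c2 \<alpha>(1) by (auto simp: c_def min_def)
  have fin1: "\<forall>\<^sub>F t in sequentially. exp (- c1 * real t) + real J * exp (- (c2 * (\<alpha>/2)) * real t) \<le> exp (- c * real t)"
  proof -
    have a: "\<forall>\<^sub>F t in sequentially. exp (- c1 * real t) \<le> exp (- c * real t) / 2"
      using c c1 by real_asymp
    define c3 where "c3 = c2 * (\<alpha>/2)"
    have "\<forall>\<^sub>F t in sequentially. (real J + 1) * exp (- c3 * real t) \<le> exp (- c * real t) / 2"
      using c(1) c(3)[folded c3_def] by real_asymp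
    with a show ?thesis unfolding c3_def[symmetric]
    proof eventually_elim
      case (elim t)
      have "real J * exp (- c3 * real t) \<le> (real J + 1) * exp (- c3 * real t)" by (intro mult_right_mono) auto
      with elim show ?case by linarith
    qed
  qed
  have "\<forall>\<^sub>F t in sequentially. real t \<ge> 2 / \<alpha>" "\<forall>\<^sub>F t in sequentially. real t \<ge> 3 * real J / \<theta>"
    using filterlim_real_sequentially by (auto simp: filterlim_at_top)
  with ball eventually_compose_filterlim[OF evs lim] fin1 eventually_gt_at_top[of 0]
  have "\<forall>\<^sub>F t in sequentially. 1 - exp (- c * real t) \<le> hit t G (grid ((1 - \<theta>) * real t) E)"
  proof eventually_elim
    case (elim t)
    define s where "s = nat \<lfloor>\<alpha> * real t\<rfloor>"
    have t0: "0 < real t" using elim by simp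
    have "0 \<le> \<alpha> * real t" using \<alpha> by simp
    then have s: "real s \<le> \<alpha> * real t" "\<alpha> * real t - 1 \<le> real s" unfolding s_def by linarith+
    have s2: "\<alpha>/2 * real t \<le> real s" using s(2) elim(5) \<alpha>(1) by (simp add: field_simps)
    let ?D = "\<lambda>j. grid (\<rho> * real t + real j * real s) E"
    let ?m = "nat \<lfloor>\<theta>/3 * real t\<rfloor>"
    have "1 - exp (- c1 * real t) \<le> hit ?m G {x. norm (emb x) \<le> r * real t}" by (rule elim(1))
    also have "\<dots> \<le> hit ?m G (?D 0)"
    proof (rule hit_mono)
      show "?D 0 \<subseteq> {x. norm (emb x) \<le> r * real t}"
      proof
        fix x assume "x \<in> ?D 0"
        then have "norm (emb x) \<le> \<rho> * real t * M" using \<rho> by (intro grid_norm) auto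
        then show "x \<in> {x. norm (emb x) \<le> r * real t}" using M_pos by (simp add: \<rho>_def)
      qed
    qed simp
    finally have start: "1 - exp (- c1 * real t) \<le> hit ?m G (?D 0)" .
    have stp: "1 - exp (- c2 * real s) \<le> hit s (?D j) (?D (Suc j))" if j: "j < J" for j
    proof -
      let ?R = "\<rho> * real t + real j * real s"
      have R0: "\<rho> * real t \<le> ?R" by simp
      then have Rpos: "?R > 0" using \<rho> t0 by (smt (verit) mult_pos_pos)
      have "real j * real s \<le> real J * (\<alpha> * real t)" using j s(1) by (intro mult_mono) auto
      then have "?R \<le> (\<rho> + real J * \<alpha>) * real t" by (simp add: algebra_simps)
      then have "\<alpha>' * ?R \<le> \<alpha>' * ((\<rho> + real J * \<alpha>) * real t)" using \<alpha>' by (intro mult_left_mono) auto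
      also have "\<dots> = \<alpha>/2 * real t"
      proof -
        have "\<rho> + real J * \<alpha> > 0" using \<rho> \<alpha>(1) by (simp add: add_pos_nonneg)
        then show ?thesis unfolding \<alpha>'_def by (simp add: field_simps)
      qed
      finally have 1: "\<alpha>' * ?R \<le> real s" using s2 by linarith
      have "real s \<le> \<beta> * \<rho> * real t" using s(1) \<alpha>(2) t0 by (elim order_trans) (auto intro: mult_right_mono)
      also have "\<dots> \<le> \<beta> * ?R" using mult_left_mono[OF R0, of \<beta>] \<beta> by (simp add: mult.assoc)
      finally have 2: "real s \<le> \<beta> * ?R" .
      have "1 - exp (- c2 * real s) \<le> hit s (grid ?R E) (grid (?R + real s) E)"
        using elim(2) Rpos 1 2 unfolding s_def[symmetric] by blast
      then show ?thesis by (simp add: algebra_simps)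
    qed
    have "1 - (exp (- c1 * real t) + real J * exp (- c2 * real s)) \<le> hit (?m + J * s) G (?D J)"
      by (rule hit_chain_steps[OF start stp])
    also have "\<dots> \<le> hit t G (?D J)"
    proof (rule hit_mono_time)
      have "real ?m \<le> \<theta>/3 * real t" using \<theta> by (intro of_nat_floor) simp
      moreover have "real (J * s) \<le> (1 - \<theta>/3) * real t"
      proof -
        have "real (J * s) \<le> real J * (\<alpha> * real t)" using s(1) by (simp add: mult_left_mono)
        also have "\<dots> \<le> (1 - \<theta>/3) * real t" using mult_right_mono[OF J(1), of "real t"] by (simp add: mult.assoc)
        finally show ?thesis .
      qed
      ultimately have "real (?m + J * s) \<le> real t" by (simp add: algebra_simps)
      then show "?m + J * s \<le> t" by (simp only: of_nat_le_iff)
    qed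
    also have "\<dots> \<le> hit t G (grid ((1 - \<theta>) * real t) E)"
    proof (rule hit_mono[OF order_refl], rule subsetI)
      fix x assume "x \<in> grid ((1 - \<theta>) * real t) E"
      then obtain y where y: "y \<in> E" "emb x = ((1 - \<theta>) * real t) *\<^sub>R y" by (auto simp: grid_def)
      let ?R = "\<rho> * real t + real J * real s"
      have "(1 - \<theta>/3 - \<alpha>) * real t \<le> real J * \<alpha> * real t" using J(2) by (intro mult_right_mono) auto
      moreover have "\<alpha> * real t \<le> \<theta>/3 * real t" using \<alpha>(3) by (intro mult_right_mono) auto
      moreover have "real J \<le> \<theta>/3 * real t" using elim(6) \<theta> by (simp add: field_simps)
      moreover have "real J * (\<alpha> * real t - 1) \<le> real J * real s" using s(2) by (intro mult_left_mono) auto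
      moreover have "0 \<le> \<rho> * real t" using \<rho> by simp
      ultimately have R: "(1 - \<theta>) * real t \<le> ?R" by (simp add: algebra_simps)
      have pos: "0 < (1 - \<theta>) * real t" using \<theta> t0 by simp
      let ?l = "(1 - \<theta>) * real t / ?R"
      have "?l *\<^sub>R y \<in> E" using R pos by (intro star y) (auto simp: divide_le_eq_1)
      moreover have "emb x = ?R *\<^sub>R (?l *\<^sub>R y)" using R pos y(2) by simp
      ultimately show "x \<in> ?D J" unfolding grid_def by blast
    qed
    finally have "1 - (exp (- c1 * real t) + real J * exp (- c2 * real s)) \<le> hit t G (grid ((1 - \<theta>) * real t) E)" .
    moreover have "real J * exp (- c2 * real s) \<le> real J * exp (- (c2 * (\<alpha>/2)) * real t)"
      using mult_left_mono[OF s2, of c2] c2 by (intro mult_left_mono) (auto simp: mult.assoc)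
    ultimately show ?case using elim(3) by linarith
  qed
  with c show ?thesis by blast
qed

end

section \<open>The limit shape\<close>

lemma (in prob_space) eventually_avoids_exponentially_rare:
  assumes B: "\<And>t. B t \<in> events" and c: "c > 0"
    and small: "\<forall>\<^sub>F t in sequentially. prob (B t) \<le> exp (- c * real t)"
  shows "AE \<omega> in M. \<forall>\<^sub>F t in sequentially. \<omega> \<notin> B t"
proof -
  have "summable (\<lambda>t. exp (- c) ^ t)" using c by (intro summable_geometric) simp
  also have "(\<lambda>t. exp (- c) ^ t) = (\<lambda>t. exp (- c * real t))"
    by (simp add: exp_of_nat_mult[symmetric] mult.commute)
  finally have "summable (\<lambda>t. prob (B t))"
    by (rule summable_comparison_test_ev[rotated]) (use small in \<open>auto elim: eventually_mono\<close>)
  then have "AE \<omega> in M. \<forall>\<^sub>F t in sequentially. \<omega> \<in> space M - B t"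
    using B by (intro borel_cantelli_AE1) (auto simp: emeasure_eq_measure)
  then show ?thesis by (auto elim!: eventually_mono)
qed

locale speed_function =
  fixes w :: "plane \<Rightarrow> real" and r :: real
  assumes r_pos: "0 < r" and r_le: "\<And>u. norm u = 1 \<Longrightarrow> r \<le> w u"
begin

definition axes :: "plane set" where
  "axes = {(1, 0), (-1, 0), (0, 1), (0, -1)}"

lemma axes_norm: "e \<in> axes \<Longrightarrow> norm e = 1"
  by (auto simp: axes_def norm_Pair)

lemma w_pos: "norm u = 1 \<Longrightarrow> 0 < w u"
  using r_le r_pos by fastforce

lemma norm_le_axes:
  assumes "\<And>e. e \<in> axes \<Longrightarrow> y \<bullet> e \<le> w e + a" "0 \<le> a"
  shows "norm y \<le> (\<Sum>e\<in>axes. w e) + 2 * a"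
proof -
  have pos: "0 < w e" if "e \<in> axes" for e using w_pos axes_norm that by blast
  have s: "(\<Sum>e\<in>axes. w e) = w (1, 0) + w (-1, 0) + w (0, 1) + w (0, -1)"
    by (simp add: axes_def)
  have "norm y \<le> \<bar>fst y\<bar> + \<bar>snd y\<bar>" by (rule norm_plane_le)
  also have "\<dots> \<le> (\<Sum>e\<in>axes. w e) + 2 * a"
    unfolding s using assms(1)[of "(1, 0)"] assms(1)[of "(-1, 0)"] assms(1)[of "(0, 1)"] assms(1)[of "(0, -1)"]
      pos[of "(1, 0)"] pos[of "(-1, 0)"] pos[of "(0, 1)"] pos[of "(0, -1)"]
    by (simp add: axes_def inner_prod_def)
  finally show ?thesis .
qed

definition radius :: real where
  "radius = (\<Sum>e\<in>axes. w e)"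

lemma mem_shape: "x \<in> K_inv_star w \<longleftrightarrow> (\<forall>u. norm u = 1 \<longrightarrow> x \<bullet> u \<le> w u)"
  by (auto simp: K_inv_star_def)

lemma shape_le: "x \<in> K_inv_star w \<Longrightarrow> norm u = 1 \<Longrightarrow> x \<bullet> u \<le> w u"
  unfolding mem_shape by blast

lemma shape_bounded: "x \<in> K_inv_star w \<Longrightarrow> norm x \<le> radius"
proof -
  assume "x \<in> K_inv_star w"
  then have "norm x \<le> (\<Sum>e\<in>axes. w e) + 2 * 0"
    by (intro norm_le_axes) (use shape_le axes_norm in auto)
  then show ?thesis by (simp add: radius_def)
qed

lemma zero_in_shape: "0 \<in> K_inv_star w"
  by (simp add: mem_shape w_pos less_imp_le)

lemma radius_nonneg: "0 \<le> radius"
  using shape_bounded[OF zero_in_shape] by simp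

lemma shape_scale:
  assumes "x \<in> K_inv_star w" "0 \<le> l" "l \<le> 1"
  shows "l *\<^sub>R x \<in> K_inv_star w"
  unfolding mem_shape
proof (intro allI impI)
  fix u :: plane assume u: "norm u = 1"
  have "l * (x \<bullet> u) \<le> l * w u" using assms(2) shape_le[OF assms(1) u] by (intro mult_left_mono)
  also have "\<dots> \<le> w u" using assms w_pos[OF u] by (simp add: mult_left_le_one_le)
  finally show "l *\<^sub>R x \<bullet> u \<le> w u" by simp
qed

text \<open>The shape is shrunk by the factor \<open>1 - 2 \<delta>\<close> and then fattened by \<open>r \<delta>\<close>. In the direction \<open>u\<close> the first operation gains
\<open>2 \<delta> w u \<ge> 2 r \<delta>\<close> and the second loses \<open>r \<delta>\<close>, so a margin \<open>r \<delta>\<close> is left.\<close>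

definition smoothed :: "real \<Rightarrow> plane set" where
  "smoothed \<delta> = (\<Union>c\<in>K_inv_star w. cball ((1 - 2 * \<delta>) *\<^sub>R c) (r * \<delta>))"

lemma droplet_smoothed:
  assumes \<delta>: "0 < \<delta>" "\<delta> < 1/2"
  shows "droplet (smoothed \<delta>) (r * \<delta>) (radius + r) (r * \<delta>) w"
proof
  show "0 < r * \<delta>" using r_pos \<delta> by auto
  show "0 < radius + r" using radius_nonneg r_pos by simp
  show "\<exists>c. y \<in> cball c (r * \<delta>) \<and> cball c (r * \<delta>) \<subseteq> smoothed \<delta>" if "y \<in> smoothed \<delta>" for y
    using that unfolding smoothed_def by blast
  fix y assume "y \<in> smoothed \<delta>"
  then obtain c where c: "c \<in> K_inv_star w" "norm (y - (1 - 2 * \<delta>) *\<^sub>R c) \<le> r * \<delta>"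
    by (auto simp: smoothed_def dist_norm norm_minus_commute)
  have "norm y \<le> norm ((1 - 2 * \<delta>) *\<^sub>R c) + norm (y - (1 - 2 * \<delta>) *\<^sub>R c)"
    by (rule norm_triangle_sub)
  moreover have "norm ((1 - 2 * \<delta>) *\<^sub>R c) \<le> 1 * radius"
    unfolding norm_scaleR using shape_bounded[OF c(1)] \<delta> by (intro mult_mono) auto
  moreover have "r * \<delta> \<le> r * 1" using r_pos \<delta> by (intro mult_left_mono) auto
  ultimately show "norm y \<le> radius + r" using c(2) by linarith
  fix u :: plane assume u: "norm u = 1"
  have "y \<bullet> u = (1 - 2 * \<delta>) * (c \<bullet> u) + (y - (1 - 2 * \<delta>) *\<^sub>R c) \<bullet> u" by (simp add: inner_simps)
  also have "\<dots> \<le> (1 - 2 * \<delta>) * w u + r * \<delta>"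
    using shape_le[OF c(1) u] \<delta> inner_unit_le[OF u, of "y - (1 - 2 * \<delta>) *\<^sub>R c"] c(2)
    by (intro add_mono mult_left_mono) auto
  also have "\<dots> \<le> w u - r * \<delta>"
    using mult_right_mono[OF r_le[OF u], of \<delta>] \<delta> by (simp add: algebra_simps)
  finally show "y \<bullet> u \<le> w u - r * \<delta>" .
qed

lemma smoothed_scale:
  assumes y: "y \<in> smoothed \<delta>" and l: "0 \<le> l" "l \<le> 1" and \<delta>: "0 < \<delta>"
  shows "l *\<^sub>R y \<in> smoothed \<delta>"
proof -
  obtain c where c: "c \<in> K_inv_star w" "norm (y - (1 - 2 * \<delta>) *\<^sub>R c) \<le> r * \<delta>"
    using y by (auto simp: smoothed_def dist_norm norm_minus_commute)
  have "l *\<^sub>R y - (1 - 2 * \<delta>) *\<^sub>R (l *\<^sub>R c) = l *\<^sub>R (y - (1 - 2 * \<delta>) *\<^sub>R c)"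
    by (simp add: algebra_simps)
  then have "norm (l *\<^sub>R y - (1 - 2 * \<delta>) *\<^sub>R (l *\<^sub>R c)) = l * norm (y - (1 - 2 * \<delta>) *\<^sub>R c)"
    using l by simp
  also have "\<dots> \<le> 1 * (r * \<delta>)" using l c(2) by (intro mult_mono) auto
  finally have "l *\<^sub>R y \<in> cball ((1 - 2 * \<delta>) *\<^sub>R (l *\<^sub>R c)) (r * \<delta>)"
    unfolding mem_cball dist_norm norm_minus_commute[of "(1 - 2 * \<delta>) *\<^sub>R (l *\<^sub>R c)"] by simp
  then show ?thesis unfolding smoothed_def using shape_scale[OF c(1) l] by blast
qed

lemma smoothed_approximates:
  assumes \<delta>: "0 < \<delta>" "\<delta> \<le> 1/4" and \<tau>: "0 < \<tau>" "1 / \<tau> \<le> \<delta> * r / 2"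
    and b: "b \<in> K_inv_star w"
  shows "\<exists>x\<in>grid ((1 - \<delta>) * \<tau>) (smoothed \<delta>). dist (emb x /\<^sub>R \<tau>) b \<le> 1 / \<tau> + 3 * \<delta> * radius"
proof -
  let ?R = "(1 - \<delta>) * \<tau>" and ?c = "(1 - 2 * \<delta>) *\<^sub>R b"
  have R: "0 < ?R" using \<delta> \<tau> by simp
  obtain x where x: "norm (emb x - ?R *\<^sub>R ?c) \<le> 1" using lattice_near by blast
  have "emb x /\<^sub>R ?R - ?c = (emb x - ?R *\<^sub>R ?c) /\<^sub>R ?R"
    unfolding scaleR_diff_right scaleR_scaleR[of "inverse ?R" ?R] left_inverse[OF R[THEN less_imp_neq, symmetric]] by simp
  then have "norm (emb x /\<^sub>R ?R - ?c) = norm (emb x - ?R *\<^sub>R ?c) / ?R"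
    using R by (simp only: norm_scaleR abs_of_pos positive_imp_inverse_positive divide_inverse_commute)
  also have "\<dots> \<le> 1 / ?R" using x R by (intro divide_right_mono) auto
  also have "\<dots> \<le> 2 * (1 / \<tau>)" using \<delta> \<tau> by (simp add: field_simps)
  also have "\<dots> \<le> r * \<delta>" using \<tau> by (simp add: mult.commute)
  finally have "emb x /\<^sub>R ?R \<in> smoothed \<delta>"
    using b by (auto simp: smoothed_def dist_norm norm_minus_commute)
  moreover have "emb x = ?R *\<^sub>R (emb x /\<^sub>R ?R)"
    unfolding scaleR_scaleR right_inverse[OF R[THEN less_imp_neq, symmetric]] by simp
  ultimately have 1: "x \<in> grid ?R (smoothed \<delta>)" unfolding grid_def by blast
  have "(?R *\<^sub>R ?c) /\<^sub>R \<tau> = ((1 - \<delta>) * (1 - 2 * \<delta>)) *\<^sub>R b" using \<tau>(1) by simp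
  then have e: "emb x /\<^sub>R \<tau> - b = (emb x - ?R *\<^sub>R ?c) /\<^sub>R \<tau> + ((1 - \<delta>) * (1 - 2 * \<delta>) - 1) *\<^sub>R b"
    by (simp only: scaleR_diff_right scaleR_diff_left) simp
  have "dist (emb x /\<^sub>R \<tau>) b \<le> norm ((emb x - ?R *\<^sub>R ?c) /\<^sub>R \<tau>) + norm (((1 - \<delta>) * (1 - 2 * \<delta>) - 1) *\<^sub>R b)"
    unfolding dist_norm e by (rule norm_triangle_ineq)
  also have "norm ((emb x - ?R *\<^sub>R ?c) /\<^sub>R \<tau>) \<le> 1 / \<tau>"
  proof -
    have "norm ((emb x - ?R *\<^sub>R ?c) /\<^sub>R \<tau>) = norm (emb x - ?R *\<^sub>R ?c) / \<tau>"
      using \<tau>(1) by (simp only: norm_scaleR abs_of_pos positive_imp_inverse_positive divide_inverse_commute)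
    then show ?thesis using x \<tau>(1) by (simp only:) (intro divide_right_mono, auto)
  qed
  also have "norm (((1 - \<delta>) * (1 - 2 * \<delta>) - 1) *\<^sub>R b) \<le> 3 * \<delta> * radius"
    unfolding norm_scaleR
  proof (rule mult_mono)
    have "(1 - \<delta>) * (1 - 2 * \<delta>) - 1 = - (3 * \<delta>) + 2 * (\<delta> * \<delta>)" by (simp add: algebra_simps)
    moreover have "\<delta> * \<delta> \<le> \<delta> * 1" using \<delta> by (intro mult_left_mono) auto
    moreover have "0 \<le> \<delta> * \<delta>" by simp
    ultimately show "\<bar>(1 - \<delta>) * (1 - 2 * \<delta>) - 1\<bar> \<le> 3 * \<delta>" using \<delta>(1) by linarith
  qed (use shape_bounded[OF b] \<delta> in auto)
  finally show ?thesis using 1 by auto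
qed

text \<open>The half-planes of the four coordinate directions confine \<open>y\<close> to a disc. The points of the disc
at distance at least \<open>\<epsilon>\<close> from the shape form a compact set, each point of which violates one of the inequalities
with a strict margin; a finite subcover yields the rest of \<open>P\<close>.\<close>

lemma finitely_many_half_planes:
  assumes \<epsilon>: "0 < \<epsilon>"
  obtains P :: "(plane \<times> real) set" where "finite P"
    "\<And>u e. (u, e) \<in> P \<Longrightarrow> norm u = 1 \<and> 0 < e"
    "\<And>y. (\<And>u e. (u, e) \<in> P \<Longrightarrow> y \<bullet> u \<le> w u + e) \<Longrightarrow> \<exists>b\<in>K_inv_star w. dist y b \<le> \<epsilon>"
proof -
  define S where "S = cball 0 (radius + 2) \<inter> (\<Inter>b\<in>K_inv_star w. {y. \<epsilon> \<le> dist y b})"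
  have "closed {y. \<epsilon> \<le> dist y b}" for b :: plane
    by (intro closed_Collect_le continuous_intros)
  then have S: "compact S" unfolding S_def by (intro compact_Int_closed compact_cball closed_INT) auto
  let ?C = "sphere 0 1 \<times> {0<..} :: (plane \<times> real) set"
  let ?V = "\<lambda>(u, e). {y. w u + e < y \<bullet> u}"
  have op: "open (?V p)" for p :: "plane \<times> real"
    by (cases p) (auto intro!: open_Collect_less continuous_intros)
  have cover: "S \<subseteq> (\<Union>p\<in>?C. ?V p)"
  proof
    fix y assume y: "y \<in> S"
    have "y \<notin> K_inv_star w" using y \<epsilon> by (auto simp: S_def)
    then obtain u where u: "norm u = 1" "w u < y \<bullet> u" by (auto simp: mem_shape not_le)
    then have "(u, (y \<bullet> u - w u) / 2) \<in> ?C" "y \<in> ?V (u, (y \<bullet> u - w u) / 2)"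
      by (auto simp: field_simps)
    then show "y \<in> (\<Union>p\<in>?C. ?V p)" by blast
  qed
  obtain C where C: "C \<subseteq> ?C" "finite C" "S \<subseteq> (\<Union>p\<in>C. ?V p)"
    using compactE_image[OF S op cover] by blast
  define P where "P = C \<union> axes \<times> {1}"
  show thesis
  proof
    show "finite P" using C by (simp add: P_def axes_def)
    show "norm u = 1 \<and> 0 < e" if "(u, e) \<in> P" for u e
    proof (cases "(u, e) \<in> C")
      case True
      then show ?thesis using C(1) by auto
    next
      case False
      then show ?thesis using that axes_norm[of u] by (auto simp: P_def)
    qed
    fix y assume y: "\<And>u e. (u, e) \<in> P \<Longrightarrow> y \<bullet> u \<le> w u + e"
    have "norm y \<le> radius + 2"
      using norm_le_axes[of y 1] y by (simp add: P_def radius_def)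
    moreover have "y \<notin> S"
    proof
      assume "y \<in> S"
      then obtain u e where "(u, e) \<in> C" "w u + e < y \<bullet> u" using C(3) by fastforce
      then show False using y[of u e] by (simp add: P_def)
    qed
    ultimately show "\<exists>b\<in>K_inv_star w. dist y b \<le> \<epsilon>"
      by (auto simp: S_def not_le intro: less_imp_le)
  qed
qed

end

lemma tendsto_zero_ennrealI:
  fixes f :: "nat \<Rightarrow> ennreal"
  assumes "\<And>k. \<forall>\<^sub>F t in sequentially. f t \<le> ennreal (1 / real (Suc k))"
  shows "f \<longlonglongrightarrow> 0"
proof (rule order_tendstoI)
  fix a :: ennreal assume "0 < a"
  then obtain e :: real where e: "0 < e" "ennreal e \<le> a"
    by (cases a) (auto simp: ennreal_zero_less_top intro: that[of 1])
  obtain k where k: "1 / real (Suc k) < e" using nat_approx_posE[OF e(1)] by auto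
  then have "ennreal (1 / real (Suc k)) < a"
    using e by (intro less_le_trans[OF _ e(2)]) (simp add: ennreal_lessI)
  then show "\<forall>\<^sub>F t in sequentially. f t < a"
    using assms[of k] by (auto elim!: eventually_mono)
qed simp

lemma hausdorff_distance_le:
  assumes "\<And>a. a \<in> A \<Longrightarrow> \<exists>b\<in>B. dist a b \<le> e" "\<And>b. b \<in> B \<Longrightarrow> \<exists>a\<in>A. dist a b \<le> e"
  shows "hausdorff_distance A B \<le> ennreal e"
  unfolding hausdorff_distance_def
proof (rule max.boundedI; rule SUP_least)
  fix a assume "a \<in> A"
  then obtain b where "b \<in> B" "dist a b \<le> e" using assms(1) by blast
  then show "(INF b\<in>B. ennreal (dist a b)) \<le> ennreal e"
    by (intro INF_lower2) (auto intro: ennreal_leI)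
next
  fix b assume "b \<in> B"
  then obtain a where "a \<in> A" "dist a b \<le> e" using assms(2) by blast
  then show "(INF a\<in>A. ennreal (dist a b)) \<le> ennreal e"
    by (intro INF_lower2) (auto intro: ennreal_leI)
qed

theorem corollary1p1:
  fixes N :: "site set" and \<pi> :: "site set \<Rightarrow> real" and p :: real
    and T :: "site set \<Rightarrow> site set" and w :: "plane \<Rightarrow> real"
    and A0 :: "site set" and M :: "'w measure" and A :: "nat \<Rightarrow> 'w \<Rightarrow> site set"
  assumes "perturbation N \<pi> p T"
    and "locally_regular T"
    and "supercritical T"
    and "\<And>u. u \<in> sphere 0 1 \<Longrightarrow> half_space_velocity N \<pi> u (w u)"
    and "finite A0"
    and "fills_space T A0"
    and "growth_process M N \<pi> A0 A"
  shows "AE \<omega> in M. (\<lambda>t. hausdorff_distance (scaled (A t \<omega>) t) (K_inv_star w)) \<longlonglongrightarrow> 0"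
proof -
  interpret random_growth N \<pi> using assms(1) by unfold_locales (simp add: perturbation_def)
  have G: "finite A0" "fills_space CA A0" using assms(1,5,6) by (simp_all add: perturbation_def)
  have vel: "half_space_velocity N \<pi> u (w u)" if "norm u = 1" for u using assms(4) that by simp
  obtain r where "r > 0" "\<And>u. norm u = 1 \<Longrightarrow> r \<le> w u"
    using velocity_bounded_below[OF G] vel by blast
  then interpret speed_function w r by unfold_locales
  have law: "one_step_law M A0 A" by (rule growth_process_one_step_law[OF assms(7)])
  interpret M: random_set M "A t" for t by (rule one_step_law_random_set[OF law])
  let ?L = "K_inv_star w"
  have upper: "AE \<omega> in M. \<forall>\<^sub>F t in sequentially. \<forall>a\<in>scaled (A t \<omega>) t. \<exists>b\<in>?L. dist a b \<le> \<epsilon>"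
    if \<epsilon>: "\<epsilon> > 0" for \<epsilon>
  proof -
    obtain P where P: "finite P" "\<And>u e. (u, e) \<in> P \<Longrightarrow> norm u = 1 \<and> 0 < e"
      and near: "\<And>y. (\<And>u e. (u, e) \<in> P \<Longrightarrow> y \<bullet> u \<le> w u + e) \<Longrightarrow> \<exists>b\<in>?L. dist y b \<le> \<epsilon>"
      using finitely_many_half_planes[OF \<epsilon>] by metis
    have "AE \<omega> in M. \<forall>\<^sub>F t in sequentially. \<not> (\<exists>x\<in>A t \<omega>. real t * (w (fst p) + snd p) < emb x \<bullet> fst p)"
      if p: "p \<in> P" for p
    proof -
      have p': "norm (fst p) = 1" "0 < snd p" using P(2)[of "fst p" "snd p"] p by auto
      let ?B = "\<lambda>t. {\<omega> \<in> space M. \<exists>x\<in>A t \<omega>. real t * (w (fst p) + snd p) < emb x \<bullet> fst p}"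
      have B: "?B t \<in> M.events" for t
      proof -
        have "?B t = {\<omega> \<in> space M. \<not> A t \<omega> \<inter> {x. real t * (w (fst p) + snd p) < emb x \<bullet> fst p} = {}}"
          by blast
        also have "\<dots> \<in> M.events" by (intro sets.sets_Collect_neg sets_avoid_event M.meas)
        finally show ?thesis .
      qed
      obtain c where "c > 0" "\<forall>\<^sub>F t in sequentially. M.prob (?B t) \<le> exp (- c * real t)"
        using finite_upper[OF p'(1) vel[OF p'(1)] p'(2) law G(1)] by blast
      from M.eventually_avoids_exponentially_rare[OF B this] show ?thesis
        by (rule AE_mp) (auto intro!: AE_I2 elim!: eventually_mono)
    qed
    then have "AE \<omega> in M. \<forall>p\<in>P. \<forall>\<^sub>F t in sequentially. \<not> (\<exists>x\<in>A t \<omega>. real t * (w (fst p) + snd p) < emb x \<bullet> fst p)"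
      using P(1) by (intro AE_finite_allI)
    then show ?thesis
    proof (rule AE_mp, intro AE_I2 impI)
      fix \<omega> assume "\<forall>p\<in>P. \<forall>\<^sub>F t in sequentially. \<not> (\<exists>x\<in>A t \<omega>. real t * (w (fst p) + snd p) < emb x \<bullet> fst p)"
      then have "\<forall>\<^sub>F t in sequentially. \<forall>p\<in>P. \<not> (\<exists>x\<in>A t \<omega>. real t * (w (fst p) + snd p) < emb x \<bullet> fst p)"
        using P(1) by (simp add: eventually_ball_finite)
      with eventually_gt_at_top[of 0]
      show "\<forall>\<^sub>F t in sequentially. \<forall>a\<in>scaled (A t \<omega>) t. \<exists>b\<in>?L. dist a b \<le> \<epsilon>"
      proof eventually_elim
        case (elim t)
        show ?case
        proof
          fix a assume "a \<in> scaled (A t \<omega>) t"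
          then obtain x where x: "x \<in> A t \<omega>" "a = emb x /\<^sub>R real t" by (auto simp: scaled_def)
          show "\<exists>b\<in>?L. dist a b \<le> \<epsilon>"
          proof (rule near)
            fix u e assume "(u, e) \<in> P"
            with elim(2) x(1) have "emb x \<bullet> u \<le> real t * (w u + e)" by (force simp: not_less)
            then show "a \<bullet> u \<le> w u + e" using elim(1) by (simp add: x(2) field_simps)
          qed
        qed
      qed
    qed
  qed
  have lower: "AE \<omega> in M. \<forall>\<^sub>F t in sequentially. \<forall>b\<in>?L. \<exists>a\<in>scaled (A t \<omega>) t. dist a b \<le> \<epsilon>"
    if \<epsilon>: "\<epsilon> > 0" for \<epsilon>
  proof -
    define \<delta> where "\<delta> = min (1/4) (\<epsilon> / (6 * (radius + 1)))"
    have \<delta>: "0 < \<delta>" "\<delta> \<le> 1/4" 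
    proof -
      show "0 < \<delta>" using \<epsilon> radius_nonneg by (simp add: \<delta>_def)
      show "\<delta> \<le> 1/4" unfolding \<delta>_def by (rule min.cobounded1)
    qed
    have "\<delta> * (6 * (radius + 1)) \<le> \<epsilon> / (6 * (radius + 1)) * (6 * (radius + 1))"
      using radius_nonneg by (intro mult_right_mono) (auto simp: \<delta>_def)
    then have "6 * \<delta> * (radius + 1) \<le> \<epsilon>" using radius_nonneg by (simp add: mult_ac)
    then have \<delta>\<epsilon>: "3 * \<delta> * radius \<le> \<epsilon> / 2" using \<delta>(1) by (simp add: algebra_simps)
    let ?F = "\<lambda>t. grid ((1 - \<delta>) * real t) (smoothed \<delta>)"
    have dr: "droplet (smoothed \<delta>) (r * \<delta>) (radius + r) (r * \<delta>) w"
      using \<delta> by (intro droplet_smoothed) auto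
    have le: "r * \<delta> \<le> w u" if "norm u = 1" for u
    proof -
      have "r * \<delta> \<le> r * 1" using r_pos \<delta> by (intro mult_left_mono) auto
      then show ?thesis using r_le[OF that] by simp
    qed
    have "\<exists>c>0. \<forall>\<^sub>F t in sequentially. 1 - exp (- c * real t) \<le> hit t A0 (?F t)"
      by (rule droplet_linear_growth[OF dr _ vel le G]) (use \<delta> smoothed_scale in auto)
    then obtain c where c: "c > 0" and ev: "\<forall>\<^sub>F t in sequentially. 1 - exp (- c * real t) \<le> hit t A0 (?F t)"
      by blast
    let ?B = "\<lambda>t. {\<omega> \<in> space M. \<not> ?F t \<subseteq> A t \<omega>}"
    have B: "?B t \<in> M.events" for t by (intro sets.sets_Collect_neg sets_subset_event M.meas)
    have "M.prob (?B t) = 1 - hit t A0 (?F t)" for t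
    proof -
      have "finite (?F t)" using \<delta> by (intro droplet.grid_finite[OF dr]) simp
      then show ?thesis
        using M.prob_neg[OF sets_subset_event[OF M.meas], of "?F t" t] one_step_law_hit[OF law] by simp
    qed
    then have "\<forall>\<^sub>F t in sequentially. M.prob (?B t) \<le> exp (- c * real t)"
      using ev by (auto elim: eventually_mono)
    from M.eventually_avoids_exponentially_rare[OF B c this]
    show ?thesis
    proof (rule AE_mp, intro AE_I2 impI)
      fix \<omega> assume w: "\<omega> \<in> space M" "\<forall>\<^sub>F t in sequentially. \<omega> \<notin> ?B t"
      have "\<forall>\<^sub>F t in sequentially. real t \<ge> 2 / (\<delta> * r)" "\<forall>\<^sub>F t in sequentially. real t \<ge> 2 / \<epsilon>"
        using filterlim_real_sequentially by (auto simp: filterlim_at_top)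
      with w(2) eventually_gt_at_top[of 0]
      show "\<forall>\<^sub>F t in sequentially. \<forall>b\<in>?L. \<exists>a\<in>scaled (A t \<omega>) t. dist a b \<le> \<epsilon>"
      proof eventually_elim
        case (elim t)
        have t: "0 < real t" "1 / real t \<le> \<delta> * r / 2" "1 / real t \<le> \<epsilon> / 2"
          using elim r_pos \<delta>(1) \<epsilon> by (auto simp: field_simps)
        show ?case
        proof
          fix b assume "b \<in> ?L"
          from smoothed_approximates[OF \<delta> t(1,2) this] obtain x
            where x: "x \<in> ?F t" "dist (emb x /\<^sub>R real t) b \<le> 1 / real t + 3 * \<delta> * radius" by blast
          have "x \<in> A t \<omega>" using elim(1) w(1) x(1) by blast
          moreover have "dist (emb x /\<^sub>R real t) b \<le> \<epsilon>" using x(2) t(3) \<delta>\<epsilon> by linarith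
          ultimately show "\<exists>a\<in>scaled (A t \<omega>) t. dist a b \<le> \<epsilon>" by (auto simp: scaled_def)
        qed
      qed
    qed
  qed
  have "AE \<omega> in M. \<forall>k. (\<forall>\<^sub>F t in sequentially. \<forall>a\<in>scaled (A t \<omega>) t. \<exists>b\<in>?L. dist a b \<le> 1 / real (Suc k))
     \<and> (\<forall>\<^sub>F t in sequentially. \<forall>b\<in>?L. \<exists>a\<in>scaled (A t \<omega>) t. dist a b \<le> 1 / real (Suc k))"
    unfolding AE_all_countable by (intro allI AE_conjI upper lower) auto
  then show ?thesis
  proof (rule AE_mp, intro AE_I2 impI tendsto_zero_ennrealI)
    fix \<omega> k assume "\<forall>k. (\<forall>\<^sub>F t in sequentially. \<forall>a\<in>scaled (A t \<omega>) t. \<exists>b\<in>?L. dist a b \<le> 1 / real (Suc k))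
     \<and> (\<forall>\<^sub>F t in sequentially. \<forall>b\<in>?L. \<exists>a\<in>scaled (A t \<omega>) t. dist a b \<le> 1 / real (Suc k))"
    then have "\<forall>\<^sub>F t in sequentially. \<forall>a\<in>scaled (A t \<omega>) t. \<exists>b\<in>?L. dist a b \<le> 1 / real (Suc k)"
      "\<forall>\<^sub>F t in sequentially. \<forall>b\<in>?L. \<exists>a\<in>scaled (A t \<omega>) t. dist a b \<le> 1 / real (Suc k)" by blast+
    then show "\<forall>\<^sub>F t in sequentially. hausdorff_distance (scaled (A t \<omega>) t) ?L \<le> ennreal (1 / real (Suc k))"
      by eventually_elim (intro hausdorff_distance_le, blast+)
  qed
qed

end
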